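(* Let $2\le q<p<\infty$. There is an algorithm which, given $A\in\mathbb R^{n\times d}$ and query access to $b\in\mathbb R^n$, reads $O(d^{q/2}\log^3d)$ entries of $b$ and outputs $\tilde x\in\mathbb R^d$ such that $$\Pr\left\{\|A\tilde x-b\|_p\le O\!\left(d^{\frac12\left(1-\frac qp\right)}\right)\min_{x\in\mathbb R^d}\|Ax-b\|_p\right\}\ge\frac{99}{100}.$$
   Context: Active regression: the design matrix $A$ is fully known to the (randomized) algorithm, while each entry of $b$ read counts as one query. Constants hidden in $O(\cdot)$ may depend on $p$ and $q$. $\log d$ is read as at least $1$. *)

theory Defs
  imports "HOL-Probability.Probability_Mass_Function" "Jordan_Normal_Form.Matrix"
begin

unbundle no vec_syntax

text \<open>
  Deterministic query algorithms are adaptive decision trees: \<open>Query i k\<close> reads entry \<open>i\<close>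
  of the hidden vector and continues with \<open>k\<close> applied to the value read.  A randomized
  algorithm is a probability distribution over such trees, i.e. all coins are tossed up front.
  Only reads are charged; computation between reads is free.
\<close>

datatype 'r query_tree = Output 'r | Query nat "real \<Rightarrow> 'r query_tree"

primrec run :: "'r query_tree \<Rightarrow> real Matrix.vec \<Rightarrow> 'r" where
  "run (Output r) b = r"
| "run (Query i k) b = run (k (b $ i)) b"

text \<open>The indices read on input \<open>b\<close>, in order and with repetitions.\<close>

primrec reads :: "'r query_tree \<Rightarrow> real Matrix.vec \<Rightarrow> nat list" where
  "reads (Output r) b = []"
| "reads (Query i k) b = i # reads (k (b $ i)) b"

definition lp_norm :: "real \<Rightarrow> real Matrix.vec \<Rightarrow> real" where
  "lp_norm p v = (\<Sum>i<dim_vec v. \<bar>v $ i\<bar> powr p) powr (1 / p)"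

text \<open>
  The infimum below is over a nonempty set bounded below by \<open>0\<close>; for \<open>p \<ge> 1\<close> it is
  attained, because the column space of \<open>A\<close> is closed.
\<close>

definition lp_regression_min :: "real \<Rightarrow> real Matrix.mat \<Rightarrow> real Matrix.vec \<Rightarrow> real" where
  "lp_regression_min p A b =
     (INF x\<in>carrier_vec (dim_col A). lp_norm p (A *\<^sub>v x - b))"

text \<open>The logarithm in query bounds, read as at least \<open>1\<close>.\<close>

definition log1 :: "nat \<Rightarrow> real" where
  "log1 d = max 1 (ln (real d))"

end

theory Submission
  imports Defs "HOL-Probability.Product_PMF" "HOL-Probability.Hoeffding"
begin

text \<open>
  Lewis weights \<open>\<pi>\<close> for the exponent \<open>p\<close>, normalised to a probability, turn the column space
  of \<open>A\<close> into a space of functions \<open>z = y / \<pi> powr (1 / p)\<close> whose sup norm is at most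
  \<open>2 \<surd>d\<close> times the norm of \<open>L\<^sub>2(\<pi>)\<close>; by interpolation the \<open>L\<^sub>p(\<pi>)\<close> norm then exceeds the
  \<open>L\<^sub>q(\<pi>)\<close> norm by at most the factor \<open>d powr (1/2 * (1 - q/p))\<close>, up to constants.  The algorithm reads
  \<open>b\<close> at independent samples from \<open>\<pi>\<close> and solves the reweighted \<open>\<ell>\<^sub>q\<close> problem on them.
  For the residual of an optimal \<open>x\<close> Markov's inequality and Jensen's inequality bound the sampled
  \<open>\<ell>\<^sub>q\<close> norm by the \<open>\<ell>\<^sub>p\<close> norm, so it suffices that the sampled \<open>L\<^sub>q\<close> norm is,
  up to a constant, at least the \<open>L\<^sub>q(\<pi>)\<close> norm uniformly over the column space.

  That lower bound is proved on each dyadic level set \<open>{\<bar>z\<bar> > t}\<close> separately.  A random sign sum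
  with mean \<open>z\<close> and error at most \<open>t / 4\<close> at all but a tiny fraction of the points has a density
  with respect to unbiased signs whose second moment is at most \<open>exp (C d log d / t\<^sup>2)\<close>.  An event
  that is rare for unbiased signs, as given by Chernoff's bound and Markov's inequality, is therefore
  avoided simultaneously for all \<open>z\<close>, by Cauchy-Schwarz.  This replaces a union bound over a net,
  and needs only \<open>d / t\<^sup>2\<close> instead of \<open>d\<close> (up to logarithms) in the exponent, which compensates the
  weight \<open>t powr q\<close> of the level and gives \<open>d powr (q / 2)\<close> samples.
\<close>

section \<open>Lewis weights\<close>

lemma powr_le_tangent:
  fixes x W \<theta> :: real
  assumes "0 \<le> x" "0 < W" "0 \<le> \<theta>" "\<theta> \<le> 1"
  shows "x powr \<theta> \<le> W powr \<theta> * (1 - \<theta> + \<theta> * x / W)"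
proof (cases "x = 0")
  case True
  then show ?thesis using assms by simp
next
  case False
  have "(x / W) powr \<theta> * 1 powr (1 - \<theta>) \<le> \<theta> * (x / W) + (1 - \<theta>) * 1"
    using False assms by (intro Youngs_inequality_0) auto
  then have "x powr \<theta> / W powr \<theta> \<le> 1 - \<theta> + \<theta> * x / W"
    using assms by (simp add: powr_divide)
  then show ?thesis using assms by (simp add: divide_le_eq mult.commute)
qed

text \<open>Jensen's inequality for a concave power, obtained by averaging the tangent bound at the
  mean \<open>W\<close>. If the mean is zero there is no tangent to use, but then every term
  vanishes.\<close>

lemma sum_powr_le_powr_sum:
  fixes p x :: "'a \<Rightarrow> real"
  assumes "finite I" "\<And>i. i \<in> I \<Longrightarrow> 0 \<le> p i" "(\<Sum>i\<in>I. p i) = 1"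
    and x: "\<And>i. i \<in> I \<Longrightarrow> 0 \<le> x i" and \<theta>: "0 \<le> \<theta>" "\<theta> \<le> 1"
  shows "(\<Sum>i\<in>I. p i * x i powr \<theta>) \<le> (\<Sum>i\<in>I. p i * x i) powr \<theta>"
proof -
  define W where "W = (\<Sum>i\<in>I. p i * x i)"
  have W0: "0 \<le> W" unfolding W_def using assms by (intro sum_nonneg) auto
  show ?thesis
  proof (cases "W = 0")
    case True
    then have "\<forall>i\<in>I. p i * x i = 0"
      unfolding W_def using assms by (subst (asm) sum_nonneg_eq_0_iff) auto
    then have "(\<Sum>i\<in>I. p i * x i powr \<theta>) = 0" by (intro sum.neutral) auto
    then show ?thesis by simp
  next
    case False
    then have W: "W > 0" using W0 by simp
    have "(\<Sum>i\<in>I. p i * x i powr \<theta>) \<le> (\<Sum>i\<in>I. p i * (W powr \<theta> * (1 - \<theta> + \<theta> * x i / W)))"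
      using assms W by (intro sum_mono mult_left_mono powr_le_tangent) auto
    also have "\<dots> = W powr \<theta> * ((1 - \<theta>) * (\<Sum>i\<in>I. p i) + \<theta> / W * (\<Sum>i\<in>I. p i * x i))"
      by (simp add: sum_distrib_left sum.distrib[symmetric] algebra_simps)
    also have "\<dots> = W powr \<theta>" using assms(3) W by (simp add: W_def[symmetric])
    finally show ?thesis unfolding W_def .
  qed
qed

lemma prod_le_average_power:
  fixes x :: "nat \<Rightarrow> real"
  assumes "T > 0" "\<And>t. t < T \<Longrightarrow> 0 \<le> x t"
  shows "(\<Prod>t<T. x t) \<le> ((\<Sum>t<T. x t) / real T) ^ T"
proof -
  have p: "0 \<le> (\<Prod>t<T. x t)" using assms by (intro prod_nonneg) auto
  have "(\<Prod>t<T. x t) powr (1 / real T) \<le> (\<Sum>t<T. x t) / real T"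
    using arith_geom_mean[of "{..<T}" x] assms by (simp add: sum_divide_distrib lessThan_empty_iff)
  then have "((\<Prod>t<T. x t) powr (1 / real T)) ^ T \<le> ((\<Sum>t<T. x t) / real T) ^ T"
    by (intro power_mono) auto
  moreover have "((\<Prod>t<T. x t) powr (1 / real T)) ^ T = (\<Prod>t<T. x t)"
    using p assms(1) by (cases "(\<Prod>t<T. x t) = 0") (simp_all add: powr_realpow[symmetric] powr_powr del: prod_zero_iff)
  ultimately show ?thesis by simp
qed

section \<open>Spans of functions and weighted orthonormal bases\<close>

text \<open>Only values on \<open>X\<close> matter, and the generators may be linearly dependent:
  they stand for the columns of a matrix of arbitrary rank.\<close>

definition lin_span :: "'a set \<Rightarrow> nat \<Rightarrow> (nat \<Rightarrow> 'a \<Rightarrow> real) \<Rightarrow> ('a \<Rightarrow> real) set" where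
  "lin_span X d f = {y. \<exists>c. \<forall>i\<in>X. y i = (\<Sum>j<d. c j * f j i)}"

lemma lin_span_cong: "y \<in> lin_span X d f \<Longrightarrow> (\<And>i. i \<in> X \<Longrightarrow> y' i = y i) \<Longrightarrow> y' \<in> lin_span X d f"
  unfolding lin_span_def by auto

lemma lin_span_base: "j < d \<Longrightarrow> f j \<in> lin_span X d f"
  unfolding lin_span_def
  by (auto intro!: exI[of _ "\<lambda>k. if k = j then 1 else 0"] simp: if_distrib[of "\<lambda>x. x * _"] cong: if_cong)

lemma lin_span_add:
  assumes "y \<in> lin_span X d f" "z \<in> lin_span X d f"
  shows "(\<lambda>i. a * y i + b * z i) \<in> lin_span X d f"
proof -
  obtain c c' where c: "\<forall>i\<in>X. y i = (\<Sum>j<d. c j * f j i)" "\<forall>i\<in>X. z i = (\<Sum>j<d. c' j * f j i)"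
    using assms unfolding lin_span_def by auto
  have "\<forall>i\<in>X. a * y i + b * z i = (\<Sum>j<d. (a * c j + b * c' j) * f j i)"
    using c by (simp add: sum_distrib_left sum.distrib[symmetric] algebra_simps)
  then show ?thesis unfolding lin_span_def by (intro CollectI exI)
qed

lemma lin_span_zero: "(\<lambda>i. 0) \<in> lin_span X d f"
  unfolding lin_span_def by (auto intro!: exI[of _ "\<lambda>_. 0"])

lemma lin_span_sum:
  assumes "\<And>k. k < (r::nat) \<Longrightarrow> g k \<in> lin_span X d f"
  shows "(\<lambda>i. \<Sum>k<r. u k * g k i) \<in> lin_span X d f"
  using assms
proof (induction r)
  case (Suc r)
  then have "(\<lambda>i. 1 * (\<Sum>k<r. u k * g k i) + u r * g r i) \<in> lin_span X d f"
    by (intro lin_span_add) auto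
  then show ?case by simp
qed (simp add: lin_span_zero)

lemma lin_span_subset:
  assumes "\<And>k. k < r \<Longrightarrow> e k \<in> lin_span X d f"
  shows "lin_span X r e \<subseteq> lin_span X d f"
proof
  fix y assume "y \<in> lin_span X r e"
  then obtain u where "\<forall>i\<in>X. y i = (\<Sum>k<r. u k * e k i)" unfolding lin_span_def by auto
  then show "y \<in> lin_span X d f"
    by (intro lin_span_cong[OF lin_span_sum[of r e X d f u, OF assms]]) auto
qed

definition orthonormal_on :: "'a set \<Rightarrow> ('a \<Rightarrow> real) \<Rightarrow> nat \<Rightarrow> (nat \<Rightarrow> 'a \<Rightarrow> real) \<Rightarrow> bool" where
  "orthonormal_on X v r e \<longleftrightarrow>
     (\<forall>k<r. \<forall>l<r. (\<Sum>i\<in>X. v i * e k i * e l i) = (if k = l then 1 else 0))"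

lemma orthonormal_coeff:
  assumes "orthonormal_on X v r e" "l < r"
  shows "(\<Sum>i\<in>X. v i * (\<Sum>k<r. u k * e k i) * e l i) = u l"
proof -
  have "(\<Sum>i\<in>X. v i * (\<Sum>k<r. u k * e k i) * e l i)
      = (\<Sum>i\<in>X. \<Sum>k<r. u k * (v i * e k i * e l i))"
    by (intro sum.cong refl) (simp add: sum_distrib_left sum_distrib_right mult_ac)
  also have "\<dots> = (\<Sum>k<r. u k * (\<Sum>i\<in>X. v i * e k i * e l i))"
    by (subst sum.swap) (simp add: sum_distrib_left)
  also have "\<dots> = (\<Sum>k<r. u k * (if k = l then 1 else 0))"
    using assms unfolding orthonormal_on_def by (intro sum.cong) auto
  also have "\<dots> = u l" using assms(2) by (simp add: if_distrib cong: if_cong)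
  finally show ?thesis .
qed

lemma orthonormal_parseval:
  assumes "orthonormal_on X v r e"
  shows "(\<Sum>i\<in>X. v i * (\<Sum>k<r. u k * e k i)\<^sup>2) = (\<Sum>k<r. (u k)\<^sup>2)"
proof -
  have "(\<Sum>i\<in>X. v i * (\<Sum>k<r. u k * e k i)\<^sup>2)
      = (\<Sum>i\<in>X. \<Sum>l<r. u l * (v i * (\<Sum>k<r. u k * e k i) * e l i))"
  proof (intro sum.cong refl)
    fix i
    have "v i * (\<Sum>k<r. u k * e k i)\<^sup>2 = v i * (\<Sum>k<r. u k * e k i) * (\<Sum>l<r. u l * e l i)"
      by (simp add: power2_eq_square)
    also have "\<dots> = (\<Sum>l<r. v i * (\<Sum>k<r. u k * e k i) * (u l * e l i))"
      by (rule sum_distrib_left)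
    finally show "v i * (\<Sum>k<r. u k * e k i)\<^sup>2 = (\<Sum>l<r. u l * (v i * (\<Sum>k<r. u k * e k i) * e l i))"
      by (simp add: mult_ac)
  qed
  also have "\<dots> = (\<Sum>l<r. u l * (\<Sum>i\<in>X. v i * (\<Sum>k<r. u k * e k i) * e l i))"
    by (subst sum.swap) (simp add: sum_distrib_left)
  also have "\<dots> = (\<Sum>l<r. u l * u l)"
    using orthonormal_coeff[OF assms] by (intro sum.cong) auto
  finally show ?thesis by (simp add: power2_eq_square)
qed

text \<open>Each new generator contributes its residual \<open>g\<close> against the basis built so
  far. If the weighted norm of \<open>g\<close> is zero, positivity of \<open>v\<close> forces
  \<open>g\<close> to vanish on \<open>X\<close> and nothing is added, so \<open>r\<close> may be
  smaller than \<open>d\<close>.\<close>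

lemma gram_schmidt:
  fixes f :: "nat \<Rightarrow> 'a \<Rightarrow> real"
  assumes "finite X" and v: "\<And>i. i \<in> X \<Longrightarrow> 0 < v i"
  shows "\<exists>r e. r \<le> d \<and> orthonormal_on X v r e \<and> lin_span X r e = lin_span X d f"
proof (induction d)
  case 0
  then show ?case
    by (intro exI[of _ 0] exI[of _ f]) (auto simp: orthonormal_on_def)
next
  case (Suc d)
  then obtain r e where r: "r \<le> d" and on: "orthonormal_on X v r e"
    and sp: "lin_span X r e = lin_span X d f" by auto
  have mono: "lin_span X d f \<subseteq> lin_span X (Suc d) f"
    by (rule lin_span_subset) (auto intro: lin_span_base)
  define a where "a k = (\<Sum>i\<in>X. v i * f d i * e k i)" for k
  define g where "g i = f d i - (\<Sum>k<r. a k * e k i)" for i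
  have orth: "(\<Sum>i\<in>X. v i * g i * e l i) = 0" if "l < r" for l
  proof -
    have "(\<Sum>i\<in>X. v i * g i * e l i) = a l - (\<Sum>i\<in>X. v i * (\<Sum>k<r. a k * e k i) * e l i)"
      unfolding g_def a_def by (simp add: sum_subtractf[symmetric] algebra_simps)
    then show ?thesis using orthonormal_coeff[OF on that, of a] by simp
  qed
  define N where "N = (\<Sum>i\<in>X. v i * (g i)\<^sup>2)"
  have N0: "0 \<le> N" unfolding N_def by (intro sum_nonneg mult_nonneg_nonneg) (auto intro: less_imp_le[OF v])
  have esub: "e k \<in> lin_span X (Suc d) f" if "k < r" for k
    using lin_span_base[OF that, of e X] sp mono by auto
  have gin: "g \<in> lin_span X (Suc d) f"
  proof -
    have "(\<lambda>i. 1 * f d i + (-1) * (\<Sum>k<r. a k * e k i)) \<in> lin_span X (Suc d) f"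
      by (intro lin_span_add lin_span_sum esub lin_span_base) auto
    then show ?thesis by (rule lin_span_cong) (simp add: g_def)
  qed
  show ?case
  proof (cases "N = 0")
    case True
    then have "\<forall>i\<in>X. v i * (g i)\<^sup>2 = 0"
      unfolding N_def using assms by (subst (asm) sum_nonneg_eq_0_iff) (auto simp: less_imp_le)
    then have g0: "\<And>i. i \<in> X \<Longrightarrow> g i = 0" using v by fastforce
    have fd: "f d \<in> lin_span X r e"
      by (rule lin_span_cong[OF lin_span_sum[of r e X r e a]]) (use g0 in \<open>auto simp: g_def intro: lin_span_base\<close>)
    have "lin_span X (Suc d) f \<subseteq> lin_span X r e"
      by (rule lin_span_subset) (metis fd less_Suc_eq lin_span_base sp)
    then have "lin_span X r e = lin_span X (Suc d) f" using mono sp by auto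
    then show ?thesis using r on by (intro exI[of _ r] exI[of _ e]) auto
  next
    case False
    then have N: "N > 0" using N0 by simp
    define e' where "e' = e(r := (\<lambda>i. g i / sqrt N))"
    have on': "orthonormal_on X v (Suc r) e'"
      unfolding orthonormal_on_def
    proof (intro allI impI)
      fix k l assume kl: "k < Suc r" "l < Suc r"
      have orth': "(\<Sum>i\<in>X. v i * (g i / sqrt N) * e l i) = 0" "(\<Sum>i\<in>X. v i * e l i * (g i / sqrt N)) = 0" if "l < r" for l
      proof -
        have "(\<Sum>i\<in>X. v i * (g i / sqrt N) * e l i) = (\<Sum>i\<in>X. v i * g i * e l i) / sqrt N"
          by (simp add: sum_divide_distrib)
        then show "(\<Sum>i\<in>X. v i * (g i / sqrt N) * e l i) = 0" using orth[OF that] by simp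
        then show "(\<Sum>i\<in>X. v i * e l i * (g i / sqrt N)) = 0" by (simp add: algebra_simps)
      qed
      have nn: "(\<Sum>i\<in>X. v i * (g i / sqrt N) * (g i / sqrt N)) = 1"
      proof -
        have "(\<Sum>i\<in>X. v i * (g i / sqrt N) * (g i / sqrt N)) = (\<Sum>i\<in>X. v i * (g i)\<^sup>2) / N"
          using N by (simp add: sum_divide_distrib power2_eq_square mult.assoc)
        then show ?thesis using N by (simp add: N_def[symmetric])
      qed
      show "(\<Sum>i\<in>X. v i * e' k i * e' l i) = (if k = l then 1 else 0)"
        using kl on orth' nn unfolding orthonormal_on_def e'_def by (auto simp: less_Suc_eq)
    qed
    have e'r: "e' k \<in> lin_span X (Suc d) f" if "k < Suc r" for k
    proof (cases "k = r")
      case True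
      have "(\<lambda>i. (1 / sqrt N) * g i + 0 * g i) \<in> lin_span X (Suc d) f" by (intro lin_span_add gin)
      then show ?thesis by (rule lin_span_cong) (simp add: e'_def True)
    next
      case False
      then show ?thesis using that esub by (simp add: e'_def)
    qed
    have eb: "e k \<in> lin_span X (Suc r) e'" if "k < r" for k
      using lin_span_base[of k "Suc r" e' X] that by (simp add: e'_def)
    have "f d \<in> lin_span X (Suc r) e'"
    proof -
      have "(\<lambda>i. sqrt N * e' r i + 1 * (\<Sum>k<r. a k * e k i)) \<in> lin_span X (Suc r) e'"
        by (intro lin_span_add lin_span_sum eb lin_span_base) auto
      then show ?thesis by (rule lin_span_cong) (use N in \<open>simp add: e'_def g_def\<close>)
    qed
    moreover have "lin_span X d f \<subseteq> lin_span X (Suc r) e'"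
      unfolding sp[symmetric] by (rule lin_span_subset) (rule eb)
    ultimately have "lin_span X (Suc d) f \<subseteq> lin_span X (Suc r) e'"
      by (intro lin_span_subset) (metis less_Suc_eq lin_span_base subsetD)
    moreover have "lin_span X (Suc r) e' \<subseteq> lin_span X (Suc d) f"
      by (rule lin_span_subset) (rule e'r)
    ultimately show ?thesis using r on' by (intro exI[of _ "Suc r"] exI[of _ e']) auto
  qed
qed

text \<open>\<open>K\<close> is the diagonal of the reproducing kernel of the span for the weighted
  inner product. Cauchy-Schwarz on the coefficients gives the pointwise bound, and the weighted sum
  of the diagonal counts the basis vectors.\<close>

lemma leverage_scores:
  fixes f :: "nat \<Rightarrow> 'a \<Rightarrow> real"
  assumes "finite X" and v: "\<And>i. i \<in> X \<Longrightarrow> 0 < v i"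
  shows "\<exists>K. (\<forall>i\<in>X. 0 \<le> K i) \<and> (\<Sum>i\<in>X. v i * K i) \<le> real d \<and>
    (\<forall>y\<in>lin_span X d f. \<forall>i\<in>X. (y i)\<^sup>2 \<le> K i * (\<Sum>j\<in>X. v j * (y j)\<^sup>2))"
proof -
  obtain r e where r: "r \<le> d" and on: "orthonormal_on X v r e"
    and sp: "lin_span X r e = lin_span X d f"
    using gram_schmidt[of X v d f] assms by auto
  define K where "K i = (\<Sum>k<r. (e k i)\<^sup>2)" for i
  have "(\<Sum>i\<in>X. v i * K i) = (\<Sum>k<r. \<Sum>i\<in>X. v i * e k i * e k i)"
    unfolding K_def sum_distrib_left by (subst sum.swap) (simp add: power2_eq_square mult.assoc)
  also have "\<dots> = real r" using on by (simp add: orthonormal_on_def)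
  finally have 1: "(\<Sum>i\<in>X. v i * K i) \<le> real d" using r by simp
  have 2: "(y i)\<^sup>2 \<le> K i * (\<Sum>j\<in>X. v j * (y j)\<^sup>2)" if y: "y \<in> lin_span X d f" and i: "i \<in> X" for y i
  proof -
    from y sp have "y \<in> lin_span X r e" by simp
    then obtain u where u: "\<forall>i\<in>X. y i = (\<Sum>k<r. u k * e k i)" unfolding lin_span_def by auto
    have "(y i)\<^sup>2 = (\<Sum>k<r. e k i * u k)\<^sup>2" using u i by (simp add: mult.commute)
    also have "\<dots> \<le> (\<Sum>k<r. (e k i)\<^sup>2) * (\<Sum>k<r. (u k)\<^sup>2)" by (rule Cauchy_Schwarz_ineq_sum)
    also have "(\<Sum>k<r. (u k)\<^sup>2) = (\<Sum>j\<in>X. v j * (\<Sum>k<r. u k * e k j)\<^sup>2)"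
      using orthonormal_parseval[OF on] by simp
    also have "\<dots> = (\<Sum>j\<in>X. v j * (y j)\<^sup>2)" using u by (intro sum.cong) auto
    finally show ?thesis by (simp add: K_def)
  qed
  show ?thesis
    by (rule exI[of _ K], intro conjI) (use 1 2 in \<open>auto simp: K_def intro: sum_nonneg\<close>)
qed

text \<open>
  With \<open>v = w powr \<theta>\<close>, iterate \<open>w \<mapsto> v * K(v) + d / n\<close>, where \<open>K(v)\<close> are the leverage scores and the
  summand \<open>d / n\<close> only keeps \<open>w\<close> positive, and average the iterates.  The logarithm of the
  optimal \<open>K(v)\<close>, a supremum of \<open>(y i)\<^sup>2 / (\<Sum>j\<in>X. v j * (y j)\<^sup>2)\<close>, is convex in \<open>v\<close>; so
  the inequality for the average follows from telescoping the product of those for the iterates.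
\<close>

lemma lewis_weights:
  fixes f :: "nat \<Rightarrow> 'a \<Rightarrow> real"
  assumes fin: "finite X" and ne: "X \<noteq> {}" and d: "d \<ge> 1" and \<theta>: "0 \<le> \<theta>" "\<theta> \<le> 1"
  shows "\<exists>w. (\<forall>i\<in>X. 0 < w i) \<and> (\<Sum>i\<in>X. w i) \<le> 2 * real d \<and>
    (\<forall>y\<in>lin_span X d f. \<forall>i\<in>X. (y i)\<^sup>2 \<le> 2 * w i powr (1 - \<theta>) * (\<Sum>j\<in>X. w j powr \<theta> * (y j)\<^sup>2))"
proof -
  define good where "good v K \<longleftrightarrow> (\<forall>i\<in>X. 0 \<le> K i) \<and> (\<Sum>i\<in>X. v i * K i) \<le> real d \<and>
    (\<forall>y\<in>lin_span X d f. \<forall>i\<in>X. (y i)\<^sup>2 \<le> K i * (\<Sum>j\<in>X. v j * (y j)\<^sup>2))" for v K :: "'a \<Rightarrow> real"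
  define Lev where "Lev v = (SOME K. good v K)" for v
  have Lev: "good v (Lev v)" if "\<And>i. i \<in> X \<Longrightarrow> 0 < v i" for v
  proof -
    have "\<exists>K. good v K" unfolding good_def by (rule leverage_scores[OF fin]) (rule that)
    then show ?thesis unfolding Lev_def by (rule someI_ex)
  qed
  define n where "n = real (card X)"
  have n: "n \<ge> 1" unfolding n_def using fin ne by (simp add: Suc_leI card_gt_0_iff)
  define w where "w = rec_nat (\<lambda>_. real d / n)
     (\<lambda>_ u i. u i powr \<theta> * Lev (\<lambda>i. u i powr \<theta>) i + real d / n)"
  have w0: "w 0 i = real d / n" for i by (simp add: w_def)
  have wS: "w (Suc t) i = w t i powr \<theta> * Lev (\<lambda>i. w t i powr \<theta>) i + real d / n" for t i
    by (simp add: w_def)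
  have dn: "real d / n > 0" using d n by simp
  have wge: "\<And>i. i \<in> X \<Longrightarrow> real d / n \<le> w t i" for t
  proof (induction t)
    case (Suc t)
    have "good (\<lambda>i. w t i powr \<theta>) (Lev (\<lambda>i. w t i powr \<theta>))"
      using Suc.IH dn by (intro Lev) (metis less_le_trans powr_gt_zero less_irrefl)
    then show ?case using Suc.prems by (simp add: wS good_def)
  qed (simp add: w0)
  have wpos: "i \<in> X \<Longrightarrow> 0 < w t i" for t i using wge[of i t] dn by linarith
  have gd: "good (\<lambda>i. w t i powr \<theta>) (Lev (\<lambda>i. w t i powr \<theta>))" for t
    using wpos by (intro Lev) (metis powr_gt_zero less_irrefl)
  have cd: "(\<Sum>i\<in>X. real d / n) = real d" using n by (simp add: n_def)
  have wsum: "(\<Sum>i\<in>X. w t i) \<le> 2 * real d" for t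
  proof (cases t)
    case 0
    then show ?thesis using cd by (simp add: w0)
  next
    case (Suc s)
    then show ?thesis using gd[of s] cd by (simp add: wS sum.distrib good_def)
  qed
  have wle: "w t i \<le> 2 * real d" if "i \<in> X" for t i
    using member_le_sum[OF that, of "w t"] wpos fin wsum[of t] by (force simp: less_imp_le)
  \<comment> \<open>The telescoped ratio of the last to the first iterate is at most
    \<open>2 * n\<close>, since iterates lie below \<open>2 * d\<close> and start at
    \<open>d / n\<close>. With this many iterates its \<open>T\<close>-th root is at most 2, which
    is the factor lost in the conclusion.\<close>
  define T where "T = nat \<lceil>2 * n\<rceil>"
  have T: "T > 0" using n unfolding T_def by linarith
  have "2 * n \<le> real T" unfolding T_def by linarith
  also have "\<dots> \<le> 2 ^ T" using of_nat_less_two_power[of T, where 'a = real] by linarith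
  finally have T2: "2 * n \<le> 2 ^ T" .
  define W where "W i = (\<Sum>t<T. w t i) / real T" for i
  have Wpos: "0 < W i" if "i \<in> X" for i
    unfolding W_def using that wpos T by (intro divide_pos_pos sum_pos) (auto simp: lessThan_empty_iff)
  have "(\<Sum>i\<in>X. W i) = (\<Sum>t<T. \<Sum>i\<in>X. w t i) / real T"
    unfolding W_def by (subst sum.swap) (simp add: sum_divide_distrib)
  also have "\<dots> \<le> (\<Sum>t<T. 2 * real d) / real T"
    by (intro divide_right_mono sum_mono wsum) auto
  finally have Wsum: "(\<Sum>i\<in>X. W i) \<le> 2 * real d" using T by simp
  have main: "(y i)\<^sup>2 \<le> 2 * W i powr (1 - \<theta>) * (\<Sum>j\<in>X. W j powr \<theta> * (y j)\<^sup>2)"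
    if y: "y \<in> lin_span X d f" and i: "i \<in> X" for y i
  proof -
    define Q where "Q t = (\<Sum>j\<in>X. w t j powr \<theta> * (y j)\<^sup>2)" for t
    define QW where "QW = (\<Sum>j\<in>X. W j powr \<theta> * (y j)\<^sup>2)"
    have Q0: "0 \<le> Q t" for t unfolding Q_def by (intro sum_nonneg) auto
    have QW0: "0 \<le> QW" unfolding QW_def by (intro sum_nonneg) auto
    \<comment> \<open>The next iterate dominates \<open>w t i powr \<theta>\<close> times the
      leverage score. Writing \<open>1 / w t i powr \<theta>\<close> as
      \<open>w t i powr (1 - \<theta>) / w t i\<close> isolates a ratio of consecutive iterates,
      which telescopes.\<close>
    have step: "(y i)\<^sup>2 \<le> (w (Suc t) i / w t i) * (w t i powr (1 - \<theta>) * Q t)" for t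
    proof -
      let ?K = "Lev (\<lambda>i. w t i powr \<theta>) i"
      have "(y i)\<^sup>2 \<le> ?K * Q t" using gd[of t] y i unfolding good_def Q_def by auto
      also have "\<dots> \<le> (w (Suc t) i / w t i powr \<theta>) * Q t"
        using wpos[OF i, of t] dn by (intro mult_right_mono Q0) (simp add: wS pos_le_divide_eq mult.commute)
      also have "w (Suc t) i / w t i powr \<theta> = (w (Suc t) i / w t i) * w t i powr (1 - \<theta>)"
        using wpos[OF i, of t] by (simp add: powr_diff)
      finally show ?thesis by (simp add: mult.assoc)
    qed
    have avgQ: "(\<Sum>t<T. Q t) / real T \<le> QW"
    proof -
      have "(\<Sum>t<T. Q t) / real T = (\<Sum>j\<in>X. (\<Sum>t<T. (1 / real T) * w t j powr \<theta>) * (y j)\<^sup>2)"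
        unfolding Q_def by (subst sum.swap) (simp add: sum_divide_distrib sum_distrib_right)
      also have "\<dots> \<le> (\<Sum>j\<in>X. (\<Sum>t<T. (1 / real T) * w t j) powr \<theta> * (y j)\<^sup>2)"
        using T wpos \<theta> by (intro sum_mono mult_right_mono sum_powr_le_powr_sum) (auto simp: less_imp_le)
      also have "\<dots> = QW" unfolding QW_def W_def by (simp add: sum_divide_distrib)
      finally show ?thesis .
    qed
    have wne: "w t i \<noteq> 0" for t using wpos[OF i, of t] by simp
    have tele: "(\<Prod>t<s. w (Suc t) i / w t i) = w s i / w 0 i" for s
      using wne by (induction s) auto
    have "w T i / w 0 i \<le> 2 * n"
      using wle[OF i, of T] d n by (simp add: w0 field_simps)
    with T2 have tele2: "(\<Prod>t<T. w (Suc t) i / w t i) \<le> 2 ^ T" by (simp add: tele)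
    \<comment> \<open>Multiplying the inequalities takes the place of averaging logarithms and needs
      no case distinction for vanishing values. AM-GM bounds the products of the
      \<open>w t i\<close> and of the \<open>Q t\<close> by powers of their averages.\<close>
    have "((y i)\<^sup>2) ^ T = (\<Prod>t<T. (y i)\<^sup>2)" by simp
    also have "\<dots> \<le> (\<Prod>t<T. (w (Suc t) i / w t i) * (w t i powr (1 - \<theta>) * Q t))"
      by (intro prod_mono conjI step) auto
    also have "\<dots> = (\<Prod>t<T. w (Suc t) i / w t i) * ((\<Prod>t<T. w t i) powr (1 - \<theta>) * (\<Prod>t<T. Q t))"
      unfolding prod.distrib
      by (subst prod_powr_distrib) (rule refl)
    also have "\<dots> \<le> 2 ^ T * ((W i ^ T) powr (1 - \<theta>) * QW ^ T)"
    proof (rule mult_mono[OF tele2 mult_mono])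
      show "(\<Prod>t<T. w t i) powr (1 - \<theta>) \<le> (W i ^ T) powr (1 - \<theta>)"
      proof (rule powr_mono2)
        show "(\<Prod>t<T. w t i) \<le> W i ^ T"
          unfolding W_def by (intro prod_le_average_power T less_imp_le[OF wpos[OF i]])
        show "0 \<le> (\<Prod>t<T. w t i)" by (intro prod_nonneg less_imp_le[OF wpos[OF i]])
      qed (use \<theta> in simp)
      have "(\<Prod>t<T. Q t) \<le> ((\<Sum>t<T. Q t) / real T) ^ T" by (intro prod_le_average_power T Q0)
      also have "\<dots> \<le> QW ^ T" using avgQ by (intro power_mono divide_nonneg_nonneg sum_nonneg Q0) auto
      finally show "(\<Prod>t<T. Q t) \<le> QW ^ T" .
      show "0 \<le> (\<Prod>t<T. Q t)" by (intro prod_nonneg Q0)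
      then show "0 \<le> (\<Prod>t<T. w t i) powr (1 - \<theta>) * (\<Prod>t<T. Q t)"
        by (intro mult_nonneg_nonneg) simp
    qed simp_all
    also have "(W i ^ T) powr (1 - \<theta>) = (W i powr (1 - \<theta>)) ^ T"
      using Wpos[OF i] by (simp add: powr_powr powr_realpow[symmetric] mult.commute)
    also have "2 ^ T * ((W i powr (1 - \<theta>)) ^ T * QW ^ T) = (2 * W i powr (1 - \<theta>) * QW) ^ T"
      by (simp add: power_mult_distrib)
    finally have "((y i)\<^sup>2) ^ Suc (T - 1) \<le> (2 * W i powr (1 - \<theta>) * QW) ^ Suc (T - 1)"
      using T by simp
    then have "(y i)\<^sup>2 \<le> 2 * W i powr (1 - \<theta>) * QW"
      by (rule power_le_imp_le_base) (intro mult_nonneg_nonneg QW0, simp_all)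
    then show ?thesis unfolding QW_def .
  qed
  show ?thesis using Wpos Wsum main by (intro exI[of _ W]) auto
qed

section \<open>Chernoff bound and random signs\<close>

lemma pmf_Markov:
  fixes f :: "'a \<Rightarrow> real"
  assumes "integrable (measure_pmf M) f" "\<And>x. x \<in> set_pmf M \<Longrightarrow> 0 \<le> f x" "0 < c"
  shows "measure_pmf.prob M {x. c \<le> f x} \<le> measure_pmf.expectation M f / c"
proof -
  have "measure (measure_pmf M) {x \<in> space (measure_pmf M). c \<le> f x} \<le> measure_pmf.expectation M f / c"
    using assms by (intro integral_Markov_inequality_measure[where A = "{}"]) (auto intro!: AE_pmfI)
  then show ?thesis by simp
qed

lemma prob_eq_sum:
  assumes "finite \<Omega>" "set_pmf M \<subseteq> \<Omega>"
  shows "measure_pmf.prob M B = (\<Sum>x\<in>\<Omega>. pmf M x * indicator B x)"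
proof -
  have "measure_pmf.prob M B = measure_pmf.expectation M (indicator B)" by simp
  also have "\<dots> = (\<Sum>x\<in>\<Omega>. pmf M x * indicator B x)"
    using assms by (subst integral_measure_pmf_real[OF assms(1)]) (auto simp: mult.commute)
  finally show ?thesis .
qed

definition hits :: "nat \<Rightarrow> (nat \<Rightarrow> 'a) \<Rightarrow> 'a set \<Rightarrow> real" where
  "hits m S B = (\<Sum>s<m. indicator B (S s))"

lemma finite_set_Pi_pmf:
  assumes "finite I" "\<And>x. x \<in> I \<Longrightarrow> finite (set_pmf (p x))"
  shows "finite (set_pmf (Pi_pmf I dflt p))"
  using assms by (intro finite_subset[OF set_Pi_pmf_subset'] finite_PiE_dflt) auto

text \<open>The moment generating function is taken at the fixed parameter -1, where one sample
  contributes at most \<open>exp (- (b / 2))\<close>. Markov's inequality at a quarter of the mean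
  leaves half of the exponent.\<close>

lemma chernoff_lower_tail:
  assumes fin: "finite (set_pmf P)"
  shows "measure_pmf.prob (Pi_pmf {..<m} dflt (\<lambda>_. P))
      {S. hits m S B < real m * measure_pmf.prob P B / 4} \<le> exp (- (real m * measure_pmf.prob P B / 4))"
proof -
  let ?Q = "Pi_pmf {..<m} dflt (\<lambda>_. P)"
  define b where "b = measure_pmf.prob P B"
  have b: "0 \<le> b" "b \<le> 1" by (auto simp: b_def)
  have finQ: "finite (set_pmf ?Q)" using fin by (intro finite_set_Pi_pmf) auto
  have e1: "exp (-1) \<le> (1/2::real)"
  proof -
    have "exp (1::real) \<ge> 2" using exp_ge_add_one_self[of "1::real"] by simp
    then show ?thesis by (simp add: exp_minus inverse_eq_divide field_simps)
  qed
  have "measure_pmf.expectation P (\<lambda>x. exp (- indicator B x)) =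
        measure_pmf.expectation P (\<lambda>x. 1 - (1 - exp (-1)) * indicator B x)"
    by (intro Bochner_Integration.integral_cong) (auto simp: indicator_def)
  also have "\<dots> = 1 - (1 - exp (-1)) * b"
    using fin by (subst Bochner_Integration.integral_diff)
      (auto intro!: integrable_measure_pmf_finite simp: b_def)
  also have "\<dots> \<le> 1 - (1/2) * b"
    using e1 b by (intro diff_left_mono mult_right_mono) auto
  also have "\<dots> \<le> exp (- (b / 2))" using exp_ge_add_one_self[of "-(b/2)"] by simp
  finally have mgf: "measure_pmf.expectation P (\<lambda>x. exp (- indicator B x)) \<le> exp (- (b / 2))" .
  have "measure_pmf.expectation ?Q (\<lambda>S. exp (- hits m S B))
      = measure_pmf.expectation ?Q (\<lambda>S. \<Prod>s<m. exp (- indicator B (S s)))"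
    by (simp add: hits_def exp_sum sum_negf[symmetric])
  also have "\<dots> = (\<Prod>s<m. measure_pmf.expectation P (\<lambda>x. exp (- indicator B x)))"
    using fin by (intro expectation_prod_Pi_pmf) (auto intro!: integrable_measure_pmf_finite)
  also have "\<dots> \<le> (\<Prod>s<m. exp (- (b / 2)))"
    by (intro prod_mono conjI mgf integral_nonneg_AE) auto
  also have "\<dots> = exp (- (real m * b / 2))" by (simp add: exp_of_nat_mult[symmetric])
  finally have E: "measure_pmf.expectation ?Q (\<lambda>S. exp (- hits m S B)) \<le> exp (- (real m * b / 2))" .
  have "measure_pmf.prob ?Q {S. hits m S B < real m * b / 4}
      \<le> measure_pmf.prob ?Q {S. exp (- (real m * b / 4)) \<le> exp (- hits m S B)}"
    by (intro measure_pmf.finite_measure_mono) auto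
  also have "\<dots> \<le> measure_pmf.expectation ?Q (\<lambda>S. exp (- hits m S B)) / exp (- (real m * b / 4))"
    using finQ by (intro pmf_Markov) (auto intro!: integrable_measure_pmf_finite)
  also have "\<dots> \<le> exp (- (real m * b / 2)) / exp (- (real m * b / 4))"
    by (intro divide_right_mono E) auto
  also have "\<dots> = exp (- (real m * b / 4))" by (simp add: exp_diff[symmetric])
  finally show ?thesis by (simp add: b_def)
qed

section \<open>Biased random signs, their concentration and their densities\<close>

text \<open>The success probability is chosen so that the mean is \<open>\<beta>\<close> whenever
  \<open>\<bar>\<beta>\<bar> \<le> 1\<close>.\<close>

definition sign_pmf :: "real \<Rightarrow> real pmf" where
  "sign_pmf \<beta> = map_pmf (\<lambda>b. if b then 1 else -1) (bernoulli_pmf ((1 + \<beta>) / 2))"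

lemma set_sign_pmf: "set_pmf (sign_pmf \<beta>) \<subseteq> {1, -1}"
  by (auto simp: sign_pmf_def)

lemma finite_set_sign_pmf [simp]: "finite (set_pmf (sign_pmf \<beta>))"
  by (rule finite_subset[OF set_sign_pmf]) auto

lemma expectation_sign_pmf:
  assumes "\<bar>\<beta>\<bar> \<le> 1"
  shows "measure_pmf.expectation (sign_pmf \<beta>) f = f 1 * ((1 + \<beta>) / 2) + f (-1) * ((1 - \<beta>) / 2 :: real)"
proof -
  have "0 \<le> (1 + \<beta>) / 2" "(1 + \<beta>) / 2 \<le> 1" using assms by auto
  moreover have "1 - (1 + \<beta>) / 2 = (1 - \<beta>) / 2" by (simp add: field_simps)
  ultimately show ?thesis unfolding sign_pmf_def by simp
qed

lemma pmf_sign_pmf: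
  assumes "\<bar>\<beta>\<bar> \<le> 1" "s \<in> {1, -1}"
  shows "pmf (sign_pmf \<beta>) s = (1 + \<beta> * s) / 2"
proof -
  have "pmf (sign_pmf \<beta>) s = measure_pmf.expectation (sign_pmf \<beta>) (indicator {s})"
    by (simp add: measure_pmf_single)
  then show ?thesis using expectation_sign_pmf[OF assms(1), of "indicator {s}"] assms(2)
    by (auto simp: indicator_def)
qed

text \<open>Hoeffding's inequality, with \<open>V\<close> only an upper bound for the sum of squares
  so that one bound serves all points. The case of vanishing coefficients is split off because
  Hoeffding's exponent divides by the sum of squares.\<close>

lemma sign_sum_tail:
  fixes c \<beta> :: "'j \<Rightarrow> real"
  assumes J: "finite J" and \<beta>: "\<And>j. j \<in> J \<Longrightarrow> \<bar>\<beta> j\<bar> \<le> 1"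
    and V: "(\<Sum>j\<in>J. (c j)\<^sup>2) \<le> V" "0 < V" and \<epsilon>: "0 < \<epsilon>"
  shows "measure_pmf.prob (Pi_pmf J 0 (\<lambda>j. sign_pmf (\<beta> j)))
      {\<omega>. \<epsilon> \<le> \<bar>(\<Sum>j\<in>J. c j * \<omega> j) - (\<Sum>j\<in>J. c j * \<beta> j)\<bar>} \<le> 2 * exp (- (\<epsilon>\<^sup>2 / (2 * V)))"
proof (cases "(\<Sum>j\<in>J. (c j)\<^sup>2) = 0")
  case True
  then have "\<forall>j\<in>J. c j = 0" using J by (subst (asm) sum_nonneg_eq_0_iff) auto
  then have "(\<Sum>j\<in>J. c j * x j) = 0" for x by (intro sum.neutral) auto
  then show ?thesis using \<epsilon> by (simp add: not_le)
next
  case False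
  let ?M = "Pi_pmf J 0 (\<lambda>j. sign_pmf (\<beta> j))"
  define W where "W = (\<Sum>j\<in>J. (c j)\<^sup>2)"
  have W: "W > 0" using False unfolding W_def by (metis order_le_less sum_nonneg zero_le_power2)
  have comp: "map_pmf (\<lambda>\<omega>. \<omega> j) ?M = sign_pmf (\<beta> j)" if "j \<in> J" for j
    using Pi_pmf_component[OF J, of j 0 "\<lambda>j. sign_pmf (\<beta> j)"] that by simp
  have ex: "measure_pmf.expectation ?M (\<lambda>\<omega>. c j * \<omega> j) = c j * \<beta> j" if "j \<in> J" for j
  proof -
    have "measure_pmf.expectation ?M (\<lambda>\<omega>. c j * \<omega> j)
        = measure_pmf.expectation (map_pmf (\<lambda>\<omega>. \<omega> j) ?M) (\<lambda>x. c j * x)" by simp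
    also have "\<dots> = c j * \<beta> j" unfolding comp[OF that]
      using expectation_sign_pmf[OF \<beta>[OF that], of "\<lambda>x. c j * x"] by (simp add: field_simps)
    finally show ?thesis .
  qed
  interpret H: Hoeffding_ineq "measure_pmf ?M" J "\<lambda>j \<omega>. c j * \<omega> j" "\<lambda>j. - \<bar>c j\<bar>" "\<lambda>j. \<bar>c j\<bar>"
     "\<Sum>j\<in>J. measure_pmf.expectation ?M (\<lambda>\<omega>. c j * \<omega> j)"
  proof unfold_locales
    show "prob_space.indep_vars (measure_pmf ?M) (\<lambda>_. borel) (\<lambda>j \<omega>. c j * \<omega> j) J"
      using prob_space.indep_vars_compose2[OF measure_pmf.prob_space_axioms indep_vars_Pi_pmf[OF J, of 0 "\<lambda>j. sign_pmf (\<beta> j)"], of "\<lambda>j x. c j * x" "\<lambda>_. borel"]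
      by simp
    fix j assume j: "j \<in> J"
    show "AE \<omega> in ?M. c j * \<omega> j \<in> {- \<bar>c j\<bar>..\<bar>c j\<bar>}"
    proof (rule AE_pmfI)
      fix \<omega> assume "\<omega> \<in> set_pmf ?M"
      then have "\<omega> j \<in> set_pmf (sign_pmf (\<beta> j))" using j J by (auto simp: set_Pi_pmf PiE_dflt_def)
      then have "\<omega> j = 1 \<or> \<omega> j = -1" using set_sign_pmf by auto
      then show "c j * \<omega> j \<in> {- \<bar>c j\<bar>..\<bar>c j\<bar>}" by auto
    qed
  qed (use J in auto)
  have s: "(\<Sum>j\<in>J. (\<bar>c j\<bar> - - \<bar>c j\<bar>)\<^sup>2) = 4 * W"
    by (simp add: W_def sum_distrib_left power_mult_distrib flip: mult_2)
  have mu: "(\<Sum>j\<in>J. measure_pmf.expectation ?M (\<lambda>\<omega>. c j * \<omega> j)) = (\<Sum>j\<in>J. c j * \<beta> j)"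
    by (intro sum.cong refl ex)
  have "measure_pmf.prob ?M {\<omega>. \<epsilon> \<le> \<bar>(\<Sum>j\<in>J. c j * \<omega> j) - (\<Sum>j\<in>J. c j * \<beta> j)\<bar>}
     \<le> 2 * exp (- 2 * \<epsilon>\<^sup>2 / (4 * W))"
    using H.Hoeffding_ineq_abs_ge[of \<epsilon>, unfolded mu s] \<epsilon> W by simp
  also have "\<dots> \<le> 2 * exp (- (\<epsilon>\<^sup>2 / (2 * V)))"
  proof -
    have "\<epsilon>\<^sup>2 / (2 * V) \<le> \<epsilon>\<^sup>2 / (2 * W)" using V W by (intro divide_left_mono) (auto simp: W_def)
    then show ?thesis by simp
  qed
  finally show ?thesis .
qed

text \<open>The biased law has density \<open>h\<close> with respect to unbiased signs.
  Cauchy-Schwarz separates the event from \<open>h\<close>, and by independence the second moment of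
  \<open>h\<close> is the product of the factors \<open>1 + (\<beta> j)\<^sup>2\<close>.\<close>

lemma sign_change_of_measure:
  fixes \<beta> :: "'j \<Rightarrow> real"
  assumes J: "finite J" and \<beta>: "\<And>j. j \<in> J \<Longrightarrow> \<bar>\<beta> j\<bar> \<le> 1"
  shows "(measure_pmf.prob (Pi_pmf J 0 (\<lambda>j. sign_pmf (\<beta> j))) B)\<^sup>2
     \<le> measure_pmf.prob (Pi_pmf J 0 (\<lambda>j. sign_pmf 0)) B * exp (\<Sum>j\<in>J. (\<beta> j)\<^sup>2)"
proof -
  let ?M = "Pi_pmf J 0 (\<lambda>j. sign_pmf (\<beta> j))" and ?U = "Pi_pmf J 0 (\<lambda>j. sign_pmf 0)"
  define \<Omega> where "\<Omega> = PiE_dflt J 0 (\<lambda>_. {1, -1 :: real})"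
  have fin: "finite \<Omega>" unfolding \<Omega>_def using J by (intro finite_PiE_dflt) auto
  have sub: "set_pmf ?M \<subseteq> \<Omega>" "set_pmf ?U \<subseteq> \<Omega>"
    using set_sign_pmf J by (fastforce simp: set_Pi_pmf \<Omega>_def PiE_dflt_def)+
  define h where "h \<omega> = (\<Prod>j\<in>J. 1 + \<beta> j * \<omega> j)" for \<omega>
  have dens: "pmf ?M \<omega> = pmf ?U \<omega> * h \<omega>" if "\<omega> \<in> \<Omega>" for \<omega>
  proof -
    have \<omega>: "\<omega> j \<in> {1, -1}" if "j \<in> J" for j
      using \<open>\<omega> \<in> \<Omega>\<close> that by (auto simp: \<Omega>_def PiE_dflt_def)
    have out: "\<omega> j = 0" if "j \<notin> J" for j
      using \<open>\<omega> \<in> \<Omega>\<close> that by (auto simp: \<Omega>_def PiE_dflt_def)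
    have "pmf ?M \<omega> = (\<Prod>j\<in>J. pmf (sign_pmf (\<beta> j)) (\<omega> j))"
      by (rule pmf_Pi'[OF J out])
    also have "\<dots> = (\<Prod>j\<in>J. (1 + \<beta> j * \<omega> j) / 2)"
      by (intro prod.cong refl pmf_sign_pmf \<beta> \<omega>)
    finally have "pmf ?M \<omega> = (\<Prod>j\<in>J. (1 + \<beta> j * \<omega> j) / 2)" .
    moreover have "pmf ?U \<omega> = (\<Prod>j\<in>J. 1 / 2)"
    proof -
      have "pmf ?U \<omega> = (\<Prod>j\<in>J. pmf (sign_pmf 0) (\<omega> j))"
        by (rule pmf_Pi'[OF J out])
      also have "\<dots> = (\<Prod>j\<in>J. 1 / 2)"
        using \<omega> by (intro prod.cong refl) (simp add: pmf_sign_pmf)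
      finally show ?thesis .
    qed
    moreover have "(\<Prod>j\<in>J. (1 + \<beta> j * \<omega> j) / 2) = (\<Prod>j\<in>J. 1 / 2) * h \<omega>"
      unfolding h_def by (subst prod.distrib[symmetric]) simp
    ultimately show ?thesis by simp
  qed
  have pr: "measure_pmf.prob N B = (\<Sum>\<omega>\<in>\<Omega>. pmf N \<omega> * indicator B \<omega>)" if "set_pmf N \<subseteq> \<Omega>" for N
    by (rule prob_eq_sum[OF fin that])
  have "measure_pmf.prob ?M B = (\<Sum>\<omega>\<in>\<Omega>. (sqrt (pmf ?U \<omega>) * indicator B \<omega>) * (sqrt (pmf ?U \<omega>) * h \<omega>))"
    unfolding pr[OF sub(1)] by (intro sum.cong) (auto simp: dens algebra_simps)
  also have "\<dots>\<^sup>2 \<le> (\<Sum>\<omega>\<in>\<Omega>. (sqrt (pmf ?U \<omega>) * indicator B \<omega>)\<^sup>2) * (\<Sum>\<omega>\<in>\<Omega>. (sqrt (pmf ?U \<omega>) * h \<omega>)\<^sup>2)"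
    by (rule Cauchy_Schwarz_ineq_sum)
  also have "(\<Sum>\<omega>\<in>\<Omega>. (sqrt (pmf ?U \<omega>) * indicator B \<omega>)\<^sup>2) = measure_pmf.prob ?U B"
    unfolding pr[OF sub(2)] by (intro sum.cong) (auto simp: indicator_def power_mult_distrib)
  also have "(\<Sum>\<omega>\<in>\<Omega>. (sqrt (pmf ?U \<omega>) * h \<omega>)\<^sup>2) = measure_pmf.expectation ?U (\<lambda>\<omega>. \<Prod>j\<in>J. (1 + \<beta> j * \<omega> j)\<^sup>2)"
    using sub by (subst integral_measure_pmf_real[OF fin])
      (auto simp: power_mult_distrib h_def prod_power_distrib mult.commute)
  also have "\<dots> = (\<Prod>j\<in>J. measure_pmf.expectation (sign_pmf 0) (\<lambda>x. (1 + \<beta> j * x)\<^sup>2))"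
    using J by (intro expectation_prod_Pi_pmf) (auto intro!: integrable_measure_pmf_finite)
  also have "\<dots> = (\<Prod>j\<in>J. 1 + (\<beta> j)\<^sup>2)"
    by (intro prod.cong) (auto simp: expectation_sign_pmf power2_eq_square field_simps)
  also have "\<dots> \<le> (\<Prod>j\<in>J. exp ((\<beta> j)\<^sup>2))"
    by (intro prod_mono) (auto simp: add_nonneg_nonneg)
  also have "\<dots> = exp (\<Sum>j\<in>J. (\<beta> j)\<^sup>2)" using J by (simp add: exp_sum)
  finally show ?thesis by (simp add: mult_left_mono)
qed

text \<open>Exchanging the two averages bounds the mean over \<open>S\<close> of the inner
  probability by \<open>c\<close>; Markov's inequality then makes it small for most single
  \<open>S\<close>.\<close>

lemma prob_swap_Markov:
  assumes M: "finite (set_pmf M)" and Q: "finite (set_pmf Q)"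
    and c: "\<And>\<omega>. measure_pmf.prob Q {S. B S \<omega>} \<le> c" and \<delta>: "0 < \<delta>"
  shows "measure_pmf.prob Q {S. \<delta> \<le> measure_pmf.prob M {\<omega>. B S \<omega>}} \<le> c / \<delta>"
proof -
  have pr: "measure_pmf.prob M {\<omega>. B S \<omega>} = (\<Sum>\<omega>\<in>set_pmf M. pmf M \<omega> * indicator {S. B S \<omega>} S)" for S
    unfolding prob_eq_sum[OF M subset_refl] by (simp add: indicator_def)
  have "measure_pmf.expectation Q (\<lambda>S. measure_pmf.prob M {\<omega>. B S \<omega>})
     = (\<Sum>\<omega>\<in>set_pmf M. pmf M \<omega> * measure_pmf.prob Q {S. B S \<omega>})"
    unfolding pr using Q by (subst Bochner_Integration.integral_sum) (auto intro!: integrable_measure_pmf_finite)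
  also have "\<dots> \<le> (\<Sum>\<omega>\<in>set_pmf M. pmf M \<omega> * c)"
    by (intro sum_mono mult_left_mono c) auto
  also have "\<dots> = c" using M by (simp add: sum_distrib_right[symmetric] sum_pmf_eq_1)
  finally have "measure_pmf.expectation Q (\<lambda>S. measure_pmf.prob M {\<omega>. B S \<omega>}) \<le> c" .
  moreover have "measure_pmf.prob Q {S. \<delta> \<le> measure_pmf.prob M {\<omega>. B S \<omega>}}
     \<le> measure_pmf.expectation Q (\<lambda>S. measure_pmf.prob M {\<omega>. B S \<omega>}) / \<delta>"
    using Q \<delta> by (intro pmf_Markov) (auto intro!: integrable_measure_pmf_finite)
  ultimately show ?thesis using \<delta> by (meson divide_right_mono less_imp_le order_trans)
qed

section \<open>Lower bound for the sampled norm\<close>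

text \<open>Each basis direction is driven by \<open>N\<close> small signs instead of one. For
  unbiased signs the coefficient of a direction has variance \<open>v\<close>, and for large
  \<open>N\<close> a bias below 1 per sign can still produce any prescribed mean
  coefficient.\<close>

definition sign_walk :: "nat \<Rightarrow> nat \<Rightarrow> real \<Rightarrow> (nat \<Rightarrow> 'a \<Rightarrow> real) \<Rightarrow> (nat \<times> nat \<Rightarrow> real) \<Rightarrow> 'a \<Rightarrow> real" where
  "sign_walk r N v e \<omega> i = (\<Sum>j\<in>{..<r} \<times> {..<N}. sqrt (v / real N) * e (fst j) i * \<omega> j)"

text \<open>The level set is heavy for \<open>P\<close>, yet receives less than a quarter of its
  expected samples. The threshold \<open>p / 2\<close> rather than \<open>p\<close> leaves room for
  replacing a function by a nearby walk.\<close>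

definition missed :: "'a pmf \<Rightarrow> nat \<Rightarrow> (nat \<Rightarrow> 'a) \<Rightarrow> real \<Rightarrow> real \<Rightarrow> ('a \<Rightarrow> real) \<Rightarrow> bool" where
  "missed P m S p t x \<longleftrightarrow> p / 2 \<le> measure_pmf.prob P {i. t < \<bar>x i\<bar>} \<and>
     hits m S {i. t < \<bar>x i\<bar>} < real m * measure_pmf.prob P {i. t < \<bar>x i\<bar>} / 4"

abbreviation sign_prior :: "nat \<Rightarrow> nat \<Rightarrow> (nat \<times> nat \<Rightarrow> real) pmf" where
  "sign_prior r N \<equiv> Pi_pmf ({..<r} \<times> {..<N}) 0 (\<lambda>_. sign_pmf 0)"

lemma sum_fst_Times: "(\<Sum>j\<in>{..<r} \<times> {..<N}. g (fst j)) = real N * (\<Sum>k<r. g k)"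
  for g :: "nat \<Rightarrow> real"
proof -
  have "(\<Sum>j\<in>{..<r} \<times> {..<N}. g (fst j)) = (\<Sum>k<r. \<Sum>l<N. g k)"
    unfolding sum.cartesian_product by (simp add: case_prod_unfold)
  then show ?thesis by (simp add: sum_distrib_left)
qed

lemma hits_le_Un: "(\<And>s. s < m \<Longrightarrow> S s \<in> A \<Longrightarrow> S s \<in> B \<or> S s \<in> C) \<Longrightarrow> hits m S A \<le> hits m S B + hits m S C"
  unfolding hits_def sum.distrib[symmetric] by (intro sum_mono) (auto simp: indicator_def)

text \<open>Here \<open>S\<close> is fixed and the hypothesis \<open>prior\<close> does not mention
  \<open>z\<close>, so a single \<open>S\<close> serves every \<open>z\<close>. Biasing the signs
  centres the walk at \<open>z\<close>; the cost of the bias is a factor \<open>exp (1 / v)\<close>,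
  which \<open>prior\<close> absorbs. Some outcome is then both not missed and close to
  \<open>z\<close> at most points and most samples, so its hits carry over to
  \<open>z\<close>.\<close>

lemma level_mass_preserved:
  fixes P :: "'a pmf" and S :: "nat \<Rightarrow> 'a"
  assumes fin: "finite (set_pmf P)"
    and eb: "\<And>i. i \<in> set_pmf P \<Longrightarrow> (\<Sum>k<r. (e k i)\<^sup>2) \<le> D" and D: "0 < D"
    and t: "0 < t" and p: "0 < p" "p \<le> 1"
    and v: "v = t\<^sup>2 / (32 * D * ln (128 / p))"
    and N: "1 / v \<le> real N"
    and u: "(\<Sum>k<r. (u k)\<^sup>2) \<le> 1" and z: "z = (\<lambda>i. \<Sum>k<r. u k * e k i)"
    and S: "\<And>s. s < m \<Longrightarrow> S s \<in> set_pmf P"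
    and prior: "measure_pmf.prob (sign_prior r N) {\<omega>. missed P m S p (3 / 4 * t) (sign_walk r N v e \<omega>)} \<le> exp (- (1 / v)) / 64"
    and heavy: "p \<le> measure_pmf.prob P {i. t < \<bar>z i\<bar>}"
  shows "5 / 32 * (real m * measure_pmf.prob P {i. t < \<bar>z i\<bar>}) \<le> hits m S {i. t / 2 < \<bar>z i\<bar>}"
proof (cases "m = 0")
  case True
  then show ?thesis by (simp add: hits_def)
next
  case False
  have l: "0 < ln (128 / p)" using p by (intro ln_gt_zero) (simp add: less_divide_eq)
  have v0: "0 < v" unfolding v using l t D by (intro divide_pos_pos mult_pos_pos) auto
  then have N0: "0 < real N" using N by (smt (verit) divide_pos_pos)
  have vN: "1 \<le> v * real N" using N v0 by (simp add: divide_le_eq mult.commute)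
  define J where "J = {..<r} \<times> {..<N}"
  have J: "finite J" by (simp add: J_def)
  \<comment> \<open>These biases give the walk mean \<open>z\<close>. The sum of their squares does
    not depend on \<open>N\<close>, while each single bias drops below 1 once
    \<open>v * N \<ge> 1\<close>.\<close>
  define \<beta> where "\<beta> = (\<lambda>j :: nat \<times> nat. u (fst j) / sqrt (v * real N))"
  define M where "M = Pi_pmf J 0 (\<lambda>j. sign_pmf (\<beta> j))"
  have finM: "finite (set_pmf M)" unfolding M_def using J by (intro finite_set_Pi_pmf) auto
  have \<beta>1: "\<bar>\<beta> j\<bar> \<le> 1" if "j \<in> J" for j
  proof -
    have "(u (fst j))\<^sup>2 \<le> (\<Sum>k<r. (u k)\<^sup>2)" using that by (intro member_le_sum) (auto simp: J_def)
    then have "(u (fst j))\<^sup>2 \<le> 1" using u by linarith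
    then have "\<bar>u (fst j)\<bar> \<le> 1" by (simp add: abs_square_le_1)
    also have "1 \<le> sqrt (v * real N)" using vN by simp
    finally show ?thesis using vN v0 N0 by (simp add: \<beta>_def abs_divide divide_le_eq)
  qed
  have \<beta>sum: "(\<Sum>j\<in>J. (\<beta> j)\<^sup>2) \<le> 1 / v"
  proof -
    have "(\<Sum>j\<in>J. (\<beta> j)\<^sup>2) = real N * (\<Sum>k<r. (u k)\<^sup>2 / (v * real N))"
      unfolding J_def \<beta>_def using v0 N0 by (subst sum_fst_Times[symmetric]) (simp add: power_divide)
    also have "\<dots> = (\<Sum>k<r. (u k)\<^sup>2) / v" using N0 by (simp add: sum_divide_distrib sum_distrib_left)
    also have "\<dots> \<le> 1 / v" using u v0 by (intro divide_right_mono) auto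
    finally show ?thesis .
  qed
  define x where "x = sign_walk r N v e"
  define \<eta> where "\<eta> = p / 64"
  define err where "err \<omega> = {i. t / 4 \<le> \<bar>x \<omega> i - z i\<bar>}" for \<omega>
  have tail: "measure_pmf.prob M {\<omega>. i \<in> err \<omega>} \<le> \<eta>" if i: "i \<in> set_pmf P" for i
  proof -
    define c where "c = (\<lambda>j :: nat \<times> nat. sqrt (v / real N) * e (fst j) i)"
    have c2: "(\<Sum>j\<in>J. (c j)\<^sup>2) \<le> v * D"
    proof -
      have "(\<Sum>j\<in>J. (c j)\<^sup>2) = real N * (\<Sum>k<r. (v / real N) * (e k i)\<^sup>2)"
        unfolding J_def c_def using v0 N0 by (subst sum_fst_Times[symmetric]) (simp add: power_mult_distrib)
      also have "\<dots> = v * (\<Sum>k<r. (e k i)\<^sup>2)" using N0 by (simp add: sum_distrib_left)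
      also have "\<dots> \<le> v * D" using eb[OF i] v0 by simp
      finally show ?thesis .
    qed
    have mean: "(\<Sum>j\<in>J. c j * \<beta> j) = z i"
    proof -
      have "sqrt (v / real N) / sqrt (v * real N) = 1 / real N"
        using v0 N0 by (simp add: real_sqrt_divide real_sqrt_mult field_simps)
      then have "c j * \<beta> j = (e (fst j) i * u (fst j)) / real N" for j
        unfolding c_def \<beta>_def
        by (metis (no_types, lifting) mult.assoc mult.commute mult.right_neutral times_divide_eq_left times_divide_eq_right)
      then have "(\<Sum>j\<in>J. c j * \<beta> j) = real N * (\<Sum>k<r. e k i * u k / real N)"
        unfolding J_def by (subst sum_fst_Times[symmetric]) simp
      then show ?thesis using N0 by (simp add: z sum_distrib_left mult.commute)
    qed
    have "measure_pmf.prob M {\<omega>. i \<in> err \<omega>}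
       = measure_pmf.prob M {\<omega>. t / 4 \<le> \<bar>(\<Sum>j\<in>J. c j * \<omega> j) - (\<Sum>j\<in>J. c j * \<beta> j)\<bar>}"
      unfolding mean by (simp add: err_def x_def sign_walk_def J_def[symmetric] c_def)
    also have "\<dots> \<le> 2 * exp (- ((t / 4)\<^sup>2 / (2 * (v * D))))"
      unfolding M_def using v0 D t by (intro sign_sum_tail J \<beta>1 c2) auto
    \<comment> \<open>This equality dictates the choice of \<open>v\<close>: the tail becomes
      \<open>2 * p / 128\<close>, a small multiple of the mass \<open>p\<close> to be
      preserved.\<close>
    also have "(t / 4)\<^sup>2 / (2 * (v * D)) = ln (128 / p)"
      using t D l by (simp add: v power2_eq_square field_simps)
    also have "2 * exp (- ln (128 / p)) = \<eta>" using p by (simp add: exp_minus \<eta>_def)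
    finally show ?thesis .
  qed
  \<comment> \<open>Adding the two kinds of error, mass under \<open>P\<close> and number of
    samples, lets one application of Markov's inequality control both.\<close>
  define G where "G \<omega> = real m * measure_pmf.prob P (err \<omega>) + hits m S (err \<omega>)" for \<omega>
  have G0: "0 \<le> G \<omega>" for \<omega> unfolding G_def hits_def by (intro add_nonneg_nonneg sum_nonneg) auto
  have int: "integrable (measure_pmf M) f" for f :: "_ \<Rightarrow> real"
    by (rule integrable_measure_pmf_finite[OF finM])
  have E1: "measure_pmf.expectation M (\<lambda>\<omega>. measure_pmf.prob P (err \<omega>)) \<le> \<eta>"
  proof -
    have "measure_pmf.expectation M (\<lambda>\<omega>. measure_pmf.prob P (err \<omega>))
      = measure_pmf.expectation M (\<lambda>\<omega>. \<Sum>i\<in>set_pmf P. pmf P i * indicator {\<omega>. i \<in> err \<omega>} \<omega>)"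
      unfolding prob_eq_sum[OF fin subset_refl] by (simp add: indicator_def)
    also have "\<dots> = (\<Sum>i\<in>set_pmf P. pmf P i * measure_pmf.prob M {\<omega>. i \<in> err \<omega>})"
      by (subst Bochner_Integration.integral_sum) (auto intro!: int)
    also have "\<dots> \<le> (\<Sum>i\<in>set_pmf P. pmf P i * \<eta>)" by (intro sum_mono mult_left_mono tail) auto
    also have "\<dots> = \<eta>" using fin by (simp add: sum_distrib_right[symmetric] sum_pmf_eq_1)
    finally show ?thesis .
  qed
  have E2: "measure_pmf.expectation M (\<lambda>\<omega>. hits m S (err \<omega>)) \<le> real m * \<eta>"
  proof -
    have "measure_pmf.expectation M (\<lambda>\<omega>. hits m S (err \<omega>))
      = measure_pmf.expectation M (\<lambda>\<omega>. \<Sum>s<m. indicator {\<omega>. S s \<in> err \<omega>} \<omega>)"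
      unfolding hits_def by (simp add: indicator_def)
    also have "\<dots> = (\<Sum>s<m. measure_pmf.prob M {\<omega>. S s \<in> err \<omega>})"
      by (subst Bochner_Integration.integral_sum) (auto intro!: int)
    also have "\<dots> \<le> (\<Sum>s<m. \<eta>)" by (intro sum_mono tail S) auto
    finally show ?thesis by simp
  qed
  have "measure_pmf.expectation M G = real m * measure_pmf.expectation M (\<lambda>\<omega>. measure_pmf.prob P (err \<omega>))
      + measure_pmf.expectation M (\<lambda>\<omega>. hits m S (err \<omega>))"
    unfolding G_def by (subst Bochner_Integration.integral_add) (auto intro!: int)
  also have "\<dots> \<le> real m * \<eta> + real m * \<eta>" using E1 E2 by (intro add_mono mult_left_mono) auto
  finally have EG: "measure_pmf.expectation M G \<le> 2 * real m * \<eta>" by (simp add: algebra_simps)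
  have \<eta>0: "0 < \<eta>" using p by (simp add: \<eta>_def)
  have "measure_pmf.prob M {\<omega>. 4 * real m * \<eta> \<le> G \<omega>} \<le> measure_pmf.expectation M G / (4 * real m * \<eta>)"
    using False \<eta>0 G0 by (intro pmf_Markov int) auto
  also have "\<dots> \<le> 2 * real m * \<eta> / (4 * real m * \<eta>)" using False \<eta>0 EG by (intro divide_right_mono) auto
  also have "\<dots> = 1 / 2" using False \<eta>0 by simp
  finally have P1: "measure_pmf.prob M {\<omega>. 4 * real m * \<eta> \<le> G \<omega>} \<le> 1 / 2" .
  define Bad where "Bad = {\<omega>. missed P m S p (3 / 4 * t) (x \<omega>)}"
  have "(measure_pmf.prob M Bad)\<^sup>2 \<le> measure_pmf.prob (sign_prior r N) Bad * exp (\<Sum>j\<in>J. (\<beta> j)\<^sup>2)"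
    unfolding M_def J_def[symmetric] by (intro sign_change_of_measure J \<beta>1)
  also have "\<dots> \<le> (exp (- (1 / v)) / 64) * exp (1 / v)"
    using prior \<beta>sum by (intro mult_mono) (auto simp: Bad_def x_def)
  also have "\<dots> = (1 / 8)\<^sup>2" by (simp add: exp_minus power2_eq_square)
  finally have P2: "measure_pmf.prob M Bad \<le> 1 / 8" by (rule power2_le_imp_le) simp
  \<comment> \<open>The two failure probabilities add up to \<open>5 / 8\<close>, so some outcome
    avoids both events.\<close>
  have "measure_pmf.prob M (Bad \<union> {\<omega>. 4 * real m * \<eta> \<le> G \<omega>}) \<le> 1 / 8 + 1 / 2"
    using P1 P2 by (intro order_trans[OF measure_Un_le]) auto
  then have "Bad \<union> {\<omega>. 4 * real m * \<eta> \<le> G \<omega>} \<noteq> UNIV" by (auto simp: measure_pmf.prob_space[simplified])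
  then obtain \<omega> where \<omega>: "\<not> missed P m S p (3 / 4 * t) (x \<omega>)" "G \<omega> < 4 * real m * \<eta>"
    unfolding Bad_def by (metis (mono_tags, lifting) UNIV_eq_I UnI1 UnI2 mem_Collect_eq not_le)
  define \<mu> where "\<mu> = measure_pmf.prob P {i. t < \<bar>z i\<bar>}"
  define \<nu> where "\<nu> = measure_pmf.prob P {i. 3 / 4 * t < \<bar>x \<omega> i\<bar>}"
  have c0: "0 \<le> hits m S B" for B unfolding hits_def by (intro sum_nonneg) auto
  have "real m * measure_pmf.prob P (err \<omega>) < real m * (p / 16)"
    using \<omega>(2) c0[of "err \<omega>"] unfolding G_def \<eta>_def by (simp add: algebra_simps)
  then have e1: "measure_pmf.prob P (err \<omega>) < p / 16"
    using False by (subst (asm) mult_less_cancel_left_pos) auto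
  have e2: "hits m S (err \<omega>) < real m * p / 16"
  proof -
    have "0 \<le> real m * measure_pmf.prob P (err \<omega>)" by simp
    moreover have "real m * measure_pmf.prob P (err \<omega>) + hits m S (err \<omega>) < real m * p / 16"
      using \<omega>(2) unfolding G_def \<eta>_def by (simp add: algebra_simps)
    ultimately show ?thesis by linarith
  qed
  have "\<mu> \<le> measure_pmf.prob P ({i. 3 / 4 * t < \<bar>x \<omega> i\<bar>} \<union> err \<omega>)"
    unfolding \<mu>_def
  proof (intro measure_pmf.finite_measure_mono subsetI)
    fix i assume "i \<in> {i. t < \<bar>z i\<bar>}"
    then have "3 / 4 * t < \<bar>x \<omega> i\<bar> \<or> t / 4 \<le> \<bar>x \<omega> i - z i\<bar>" unfolding mem_Collect_eq by linarith
    then show "i \<in> {i. 3 / 4 * t < \<bar>x \<omega> i\<bar>} \<union> err \<omega>" unfolding err_def by blast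
  qed simp
  also have "\<dots> \<le> \<nu> + measure_pmf.prob P (err \<omega>)" unfolding \<nu>_def by (intro measure_Un_le) auto
  finally have \<nu>: "\<nu> \<ge> \<mu> - p / 16" using e1 by simp
  have hp: "p \<le> \<mu>" using heavy by (simp add: \<mu>_def)
  have "hits m S {i. 3 / 4 * t < \<bar>x \<omega> i\<bar>} \<ge> real m * \<nu> / 4"
    using \<omega>(1) \<nu> hp p unfolding missed_def \<nu>_def[symmetric] by auto
  moreover have "hits m S {i. 3 / 4 * t < \<bar>x \<omega> i\<bar>} \<le> hits m S {i. t / 2 < \<bar>z i\<bar>} + hits m S (err \<omega>)"
  proof (rule hits_le_Un)
    fix s assume "S s \<in> {i. 3 / 4 * t < \<bar>x \<omega> i\<bar>}"
    then have "t / 2 < \<bar>z (S s)\<bar> \<or> t / 4 \<le> \<bar>x \<omega> (S s) - z (S s)\<bar>" unfolding mem_Collect_eq by linarith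
    then show "S s \<in> {i. t / 2 < \<bar>z i\<bar>} \<or> S s \<in> err \<omega>" unfolding err_def by blast
  qed
  ultimately have "hits m S {i. t / 2 < \<bar>z i\<bar>} \<ge> real m * \<nu> / 4 - real m * p / 16" using e2 by linarith
  moreover have "real m * \<nu> / 4 - real m * p / 16 = real m * (\<nu> / 4 - p / 16)" by (simp add: algebra_simps)
  \<comment> \<open>Inserting \<open>\<nu> \<ge> \<mu> - p / 16\<close> and
    \<open>p \<le> \<mu>\<close> leaves at least \<open>11 / 64 * \<mu>\<close>, which exceeds
    \<open>5 / 32 * \<mu>\<close>.\<close>
  moreover have "real m * (\<nu> / 4 - p / 16) \<ge> real m * (5 / 32 * \<mu>)"
    using \<nu> hp p by (intro mult_left_mono) auto
  ultimately show ?thesis unfolding \<mu>_def by linarith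
qed

text \<open>For a fixed outcome the walk is one fixed function, to which Chernoff's bound applies
  with mass at least \<open>p / 2\<close>. Swapping the order of randomness gives a statement about
  typical samples \<open>S\<close>.\<close>

lemma missed_prior_prob:
  fixes P :: "'a pmf"
  assumes fin: "finite (set_pmf P)" and "0 < \<delta>"
  shows "measure_pmf.prob (Pi_pmf {..<m} dflt (\<lambda>_. P))
     {S. \<delta> \<le> measure_pmf.prob (sign_prior r N) {\<omega>. missed P m S p t (sign_walk r N v e \<omega>)}}
     \<le> exp (- (real m * p / 8)) / \<delta>"
proof (rule prob_swap_Markov)
  fix \<omega>
  let ?A = "{i. t < \<bar>sign_walk r N v e \<omega> i\<bar>}"
  show "measure_pmf.prob (Pi_pmf {..<m} dflt (\<lambda>_. P)) {S. missed P m S p t (sign_walk r N v e \<omega>)}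
      \<le> exp (- (real m * p / 8))"
  proof (cases "p / 2 \<le> measure_pmf.prob P ?A")
    case True
    have "measure_pmf.prob (Pi_pmf {..<m} dflt (\<lambda>_. P)) {S. missed P m S p t (sign_walk r N v e \<omega>)}
      \<le> measure_pmf.prob (Pi_pmf {..<m} dflt (\<lambda>_. P)) {S. hits m S ?A < real m * measure_pmf.prob P ?A / 4}"
      by (intro measure_pmf.finite_measure_mono) (auto simp: missed_def)
    also have "\<dots> \<le> exp (- (real m * measure_pmf.prob P ?A / 4))" by (rule chernoff_lower_tail[OF fin])
    also have "\<dots> \<le> exp (- (real m * p / 8))"
      using mult_left_mono[OF True, of "real m"] by (simp add: mult.commute)
    finally show ?thesis .
  qed (simp add: missed_def)
qed (use assms in \<open>auto intro!: finite_set_Pi_pmf\<close>)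

section \<open>Dyadic decomposition of the norms\<close>

text \<open>The sum is geometric and dominated by its largest level below \<open>s\<close>. Hence
  counting one sample on all the levels that it hits costs only a factor 2.\<close>

lemma geometric_level_sum:
  fixes q s :: real
  assumes q: "1 \<le> q" and "0 \<le> s"
  shows "(\<Sum>l<L. (2 ^ l) powr q * of_bool (2 ^ l < s)) \<le> 2 * s powr q"
proof -
  have A: "(\<Sum>l<L. (2 ^ l) powr q) \<le> (2 ^ L) powr q" for L :: nat
  proof (induction L)
    case (Suc L)
    have "2 powr 1 \<le> (2::real) powr q" using q by (intro powr_mono) auto
    then have "2 * (2 ^ L) powr q \<le> 2 powr q * (2 ^ L :: real) powr q"
      by (intro mult_right_mono) auto
    also have "\<dots> = (2 ^ Suc L) powr q" by (simp add: powr_mult)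
    finally show ?case using Suc by simp
  qed simp
  show ?thesis
  proof (induction L)
    case (Suc L)
    show ?case
    proof (cases "2 ^ L < s")
      case True
      have "(\<Sum>l<Suc L. (2 ^ l) powr q * of_bool (2 ^ l < s)) \<le> (\<Sum>l<Suc L. (2 ^ l) powr q)"
        by (intro sum_mono) (auto simp: of_bool_def)
      also have "\<dots> \<le> 2 * (2 ^ L) powr q" using A[of L] by simp
      also have "\<dots> \<le> 2 * s powr q" using True q by (intro mult_left_mono powr_mono2) auto
      finally show ?thesis .
    qed (use Suc in simp)
  qed simp
qed

text \<open>The largest threshold \<open>2 ^ l / 2\<close> below \<open>a\<close> belongs to a level
  with \<open>a \<le> 2 ^ l\<close>, so that level's weight alone dominates \<open>a powr q\<close>.
  Values up to \<open>1 / 2\<close> are covered by the constant term.\<close>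

lemma powr_le_level_sum:
  fixes q a :: real
  assumes q: "0 \<le> q" and "0 \<le> a" "a \<le> 2 ^ L / 2"
  shows "a powr q \<le> (1 / 2) powr q + (\<Sum>l<L. (2 ^ l) powr q * of_bool (2 ^ l / 2 < a))"
  using assms(3)
proof (induction L)
  case 0
  then show ?case using assms by (auto intro!: powr_mono2)
next
  case (Suc L)
  show ?case
  proof (cases "a \<le> 2 ^ L / 2")
    case True
    then show ?thesis using Suc.IH by (simp add: add_nonneg_nonneg)
  next
    case False
    have "a powr q \<le> (2 ^ L) powr q" using Suc.prems assms by (intro powr_mono2) auto
    moreover have "0 \<le> (\<Sum>l<L. (2 ^ l) powr q * of_bool (2 ^ l / 2 < a))" by (intro sum_nonneg) auto
    moreover have "0 \<le> (1 / 2 :: real) powr q" by simp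
    moreover have "(\<Sum>l<Suc L. (2 ^ l) powr q * of_bool (2 ^ l / 2 < a))
        = (\<Sum>l<L. (2 ^ l) powr q * of_bool (2 ^ l / 2 < a)) + (2 ^ L) powr q"
      using False by simp
    ultimately show ?thesis by linarith
  qed
qed

text \<open>Values up to \<open>1 / 2\<close> account for at most a quarter of the norm because
  \<open>q \<ge> 2\<close>, and the levels too light for \<open>lev\<close> for at most another
  quarter in total. The heavy levels carry the remaining half, which \<open>lev\<close> transfers to
  the sample.\<close>

lemma empirical_bound_from_levels:
  fixes P :: "'a pmf" and q :: real
  assumes fin: "finite (set_pmf P)" and q: "2 \<le> q" and L: "0 < L"
    and zb: "\<And>i. i \<in> set_pmf P \<Longrightarrow> \<bar>z i\<bar> \<le> 2 ^ L / 2"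
    and norm: "(\<Sum>i\<in>set_pmf P. pmf P i * \<bar>z i\<bar> powr q) = 1"
    and lev: "\<And>l. l < L \<Longrightarrow> 1 / (4 * real L * (2 ^ l) powr q) \<le> measure_pmf.prob P {i. 2 ^ l / 2 < \<bar>z i\<bar>} \<Longrightarrow>
       5 / 32 * (real m * measure_pmf.prob P {i. 2 ^ l / 2 < \<bar>z i\<bar>}) \<le> hits m S {i. 2 ^ l / 2 / 2 < \<bar>z i\<bar>}"
  shows "real m \<le> 32 * 4 powr q * (\<Sum>s<m. \<bar>z (S s)\<bar> powr q)"
proof -
  define \<mu> where "\<mu> l = measure_pmf.prob P {i. 2 ^ l / 2 < \<bar>z i\<bar>}" for l :: nat
  define C where "C l = hits m S {i. 2 ^ l / 2 / 2 < \<bar>z i\<bar>}" for l :: nat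
  have half: "(1 / 2) powr q \<le> (1 / 4 :: real)"
  proof -
    have "(1 / 2) powr q \<le> (1 / 2 :: real) powr 2" using q by (intro powr_mono') auto
    then show ?thesis by (simp add: power2_eq_square)
  qed
  have "1 = (\<Sum>i\<in>set_pmf P. pmf P i * \<bar>z i\<bar> powr q)" using norm by simp
  also have "\<dots> \<le> (\<Sum>i\<in>set_pmf P. pmf P i * ((1 / 2) powr q + (\<Sum>l<L. (2 ^ l) powr q * of_bool (2 ^ l / 2 < \<bar>z i\<bar>))))"
    using q zb by (intro sum_mono mult_left_mono powr_le_level_sum) auto
  also have "\<dots> = (\<Sum>i\<in>set_pmf P. pmf P i) * (1 / 2) powr q
      + (\<Sum>i\<in>set_pmf P. \<Sum>l<L. (2 ^ l) powr q * (pmf P i * of_bool (2 ^ l / 2 < \<bar>z i\<bar>)))"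
    by (simp only: distrib_left sum.distrib sum_distrib_right sum_distrib_left mult.left_commute)
  also have "(\<Sum>i\<in>set_pmf P. \<Sum>l<L. (2 ^ l) powr q * (pmf P i * of_bool (2 ^ l / 2 < \<bar>z i\<bar>)))
      = (\<Sum>l<L. (2 ^ l) powr q * \<mu> l)"
    unfolding \<mu>_def prob_eq_sum[OF fin subset_refl]
    by (subst sum.swap) (simp add: sum_distrib_left indicator_def)
  also have "(\<Sum>i\<in>set_pmf P. pmf P i) = 1" using fin by (simp add: sum_pmf_eq_1)
  finally have low: "3 / 4 \<le> (\<Sum>l<L. (2 ^ l) powr q * \<mu> l)" using half by simp
  have each: "5 / 32 * real m * ((2 ^ l) powr q * \<mu> l - 1 / (4 * real L)) \<le> (2 ^ l) powr q * C l" if l: "l < L" for l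
  proof (cases "1 / (4 * real L * (2 ^ l) powr q) \<le> \<mu> l")
    case True
    then have c: "5 / 32 * (real m * \<mu> l) \<le> C l" using lev[OF l] by (simp add: \<mu>_def C_def)
    have "5 / 32 * real m * ((2 ^ l) powr q * \<mu> l - 1 / (4 * real L)) \<le> 5 / 32 * real m * ((2 ^ l) powr q * \<mu> l)"
      by (intro mult_left_mono) auto
    also have "\<dots> = (2 ^ l) powr q * (5 / 32 * (real m * \<mu> l))" by simp
    also have "\<dots> \<le> (2 ^ l) powr q * C l" by (intro mult_left_mono c) auto
    finally show ?thesis .
  next
    case False
    then have "(2 ^ l) powr q * \<mu> l \<le> 1 / (4 * real L)"
      using L by (simp add: field_simps)
    then have "5 / 32 * real m * ((2 ^ l) powr q * \<mu> l - 1 / (4 * real L)) \<le> 0"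
      by (intro mult_nonneg_nonpos) auto
    also have "0 \<le> (2 ^ l) powr q * C l" unfolding C_def hits_def by (intro mult_nonneg_nonneg sum_nonneg) auto
    finally show ?thesis .
  qed
  have "real m / 16 \<le> 5 / 32 * real m * ((\<Sum>l<L. (2 ^ l) powr q * \<mu> l) - 1 / 4)"
  proof -
    have "5 / 32 * real m * (1 / 2) \<le> 5 / 32 * real m * ((\<Sum>l<L. (2 ^ l) powr q * \<mu> l) - 1 / 4)"
      using low by (intro mult_left_mono) auto
    then show ?thesis by simp
  qed
  also have "\<dots> = (\<Sum>l<L. 5 / 32 * real m * ((2 ^ l) powr q * \<mu> l - 1 / (4 * real L)))"
  proof -
    have "(\<Sum>l<L. (2 ^ l) powr q * \<mu> l) - 1 / 4 = (\<Sum>l<L. (2 ^ l) powr q * \<mu> l - 1 / (4 * real L))"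
      using L by (simp add: sum_subtractf)
    then show ?thesis by (simp only: sum_distrib_left)
  qed
  also have "\<dots> \<le> (\<Sum>l<L. (2 ^ l) powr q * C l)" by (intro sum_mono each) auto
  \<comment> \<open>Exchanging the sums collects, for each sample, all levels that it hits. The
    halved thresholds \<open>2 ^ l / 4\<close> are the source of the factor
    \<open>4 powr q\<close>.\<close>
  also have "\<dots> = (\<Sum>s<m. \<Sum>l<L. (2 ^ l) powr q * of_bool (2 ^ l < 4 * \<bar>z (S s)\<bar>))"
    unfolding C_def hits_def sum_distrib_left
    by (subst sum.swap) (intro sum.cong refl, auto simp: indicator_def)
  also have "\<dots> \<le> (\<Sum>s<m. 2 * (4 * \<bar>z (S s)\<bar>) powr q)"
    using q by (intro sum_mono geometric_level_sum) auto
  also have "\<dots> = 2 * 4 powr q * (\<Sum>s<m. \<bar>z (S s)\<bar> powr q)"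
    by (simp add: powr_mult sum_distrib_left mult.assoc)
  finally show ?thesis by simp
qed

section \<open>Choice of parameters and union bound over the levels\<close>

lemma log1_ge: "1 \<le> log1 d" "ln (real d) \<le> log1 d"
  by (auto simp: log1_def)

text \<open>The factors are collected in \<open>level_parameters\<close>: \<open>128\<close> is
  \<open>32\<close> times the 4 in \<open>L \<le> 4 * \<Lambda>\<close>, \<open>4 powr q\<close>
  comes from \<open>2 ^ l \<le> 4 * sqrt d\<close>, the first summand bounds the cost
  \<open>1 / v\<close>, and \<open>51200\<close> bounds the logarithm for the union over
  levels.\<close>

definition sample_const :: "real \<Rightarrow> real" where
  "sample_const q = 128 * 4 powr q * (512 * (2048 + 3 * q) + 51200)"

text \<open>The Chernoff exponent \<open>m * p / 8\<close> must beat \<open>1 / v\<close> plus a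
  logarithm for the union bound. One logarithm of the sample size comes from the number of levels
  inside \<open>p\<close>, the other from \<open>ln (128 / p)\<close> inside
  \<open>v\<close>.\<close>

lemma level_parameters:
  fixes q :: real and d l m :: nat
  defines "L \<equiv> nat \<lceil>log 2 (4 * sqrt (real d))\<rceil>"
  defines "p \<equiv> 1 / (4 * real L * (2 ^ l) powr q)"
  defines "v \<equiv> (2 ^ l / 2)\<^sup>2 / (32 * (4 * real d) * ln (128 / p))"
  assumes q: "2 \<le> q" and d: "1 \<le> d" and l: "l < L"
    and m: "sample_const q * (real d powr (q / 2) * log1 d ^ 2) \<le> real m"
  shows "0 < p" "p \<le> 1" "exp (- (real m * p / 8)) / (exp (- (1 / v)) / 64) \<le> 1 / (200 * real L)"
proof -
  define s :: real where "s = 2 ^ l"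
  define \<Lambda> where "\<Lambda> = log1 d"
  have \<Lambda>: "1 \<le> \<Lambda>" "ln (real d) \<le> \<Lambda>" by (simp_all add: \<Lambda>_def log1_ge)
  have s1: "1 \<le> s" by (simp add: s_def)
  have L0: "0 < L" using l by simp
  have sd: "1 \<le> sqrt (real d)" using d by simp
  have sl: "s \<le> 4 * sqrt (real d)"
  proof -
    have "real l < log 2 (4 * sqrt (real d))" using l unfolding L_def by linarith
    then have "2 powr real l < 2 powr (log 2 (4 * sqrt (real d)))" by simp
    then show ?thesis using d by (simp add: s_def powr_realpow)
  qed
  have LL: "real L \<le> 4 * \<Lambda>"
  proof -
    have "1 \<le> 4 * sqrt (real d)" using sd by linarith
    then have "0 \<le> log 2 (4 * sqrt (real d))" using d by (subst zero_le_log_cancel_iff) auto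
    then have "real L \<le> log 2 (4 * sqrt (real d)) + 1" unfolding L_def by linarith
    also have "log 2 (4 * sqrt (real d)) = log 2 (2 powr 2) + log 2 (real d powr (1 / 2))"
      using d by (subst log_mult_pos[symmetric]) (auto simp: powr_half_sqrt)
    also have "log 2 (2 powr 2) = (2::real)" by (rule log_powr_cancel) auto
    also have "log 2 (real d powr (1 / 2)) = ln (real d) / ln 2 / 2" using d by (simp add: log_def ln_powr)
    also have "ln (real d) / ln 2 \<le> ln (real d) / (1 / 2)"
      using d ln2_ge_two_thirds by (intro divide_left_mono) auto
    finally show ?thesis using \<Lambda> by simp
  qed
  have L1: "1 \<le> real L" using L0 by simp
  have spos: "0 < s powr q" using s1 by simp
  have sge: "1 \<le> s powr q" using s1 q by (intro ge_one_powr_ge_zero) auto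
  have pdef: "p = 1 / (4 * real L * s powr q)" by (simp add: p_def s_def)
  show p0: "0 < p" unfolding pdef using L0 spos by simp
  have "1 * 1 \<le> (4 * real L) * s powr q" using L1 sge by (intro mult_mono) auto
  then show "p \<le> 1" unfolding pdef using L0 spos by (simp add: divide_le_eq)
  have lnp: "ln (128 / p) \<le> (2048 + 3 * q) * \<Lambda>"
  proof -
    have "128 / p = (512 * real L) * s powr q" by (simp add: pdef)
    then have "ln (128 / p) = ln (512 * real L) + q * ln s"
      using L0 spos s1 by (simp add: ln_mult ln_powr)
    also have "ln (512 * real L) \<le> 512 * real L" using L0 ln_le_minus_one[of "512 * real L"] by simp
    also have "ln s \<le> ln (4 * sqrt (real d))" using sl s1 sd by simp
    also have "\<dots> = ln 4 + ln (real d) / 2" using d by (simp add: ln_mult ln_sqrt)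
    also have "ln 4 = 2 * ln (2::real)" using ln_realpow[of "2::real" 2] by simp
    also have "ln (2::real) \<le> 1" using ln_2_less_1 by simp
    also have "512 * real L + q * (2 * 1 + ln (real d) / 2) \<le> 512 * (4 * \<Lambda>) + q * (3 * \<Lambda>)"
      using LL \<Lambda> q by (intro add_mono mult_left_mono) auto
    finally show ?thesis using q by (simp add: algebra_simps)
  qed
  have lnp0: "0 < ln (128 / p)" using p0 \<open>p \<le> 1\<close> by (intro ln_gt_zero) (simp add: less_divide_eq)
  have vinv: "1 / v = 512 * real d * ln (128 / p) / s\<^sup>2"
    by (simp add: v_def s_def power_divide)
  have pow: "(4 * sqrt (real d)) powr a = 4 powr a * real d powr (a / 2)" for a
    using d by (simp add: powr_mult powr_half_sqrt[symmetric] powr_powr)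
  have sq: "s powr q \<le> 4 powr q * real d powr (q / 2)"
    unfolding pow[symmetric] using sl s1 q by (intro powr_mono2) auto
  \<comment> \<open>Here the gain over a net argument appears: the cost is
    \<open>d / s\<^sup>2\<close>, so the weight \<open>s powr q\<close> is reduced to
    \<open>s powr (q - 2)\<close> and \<open>s \<le> 4 * sqrt d\<close> suffices for
    \<open>d powr (q / 2)\<close>.\<close>
  have sq2: "real d * (s powr q / s\<^sup>2) \<le> 4 powr q * real d powr (q / 2)"
  proof -
    have "s powr q / s\<^sup>2 = s powr (q - 2)" using s1 by (simp add: powr_diff)
    also have "\<dots> \<le> (4 * sqrt (real d)) powr (q - 2)" using sl s1 q by (intro powr_mono2) auto
    also have "\<dots> \<le> 4 powr q * real d powr ((q - 2) / 2)"
      unfolding pow by (intro mult_right_mono powr_mono) auto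
    finally have "real d * (s powr q / s\<^sup>2) \<le> real d * (4 powr q * real d powr ((q - 2) / 2))"
      by (rule mult_left_mono) simp
    also have "\<dots> = real d powr 1 * (4 powr q * real d powr ((q - 2) / 2))"
      using d by simp
    also have "\<dots> = 4 powr q * (real d powr 1 * real d powr ((q - 2) / 2))" by (simp only: mult.left_commute)
    also have "real d powr 1 * real d powr ((q - 2) / 2) = real d powr (q / 2)"
      by (subst powr_add[symmetric]) (simp add: field_simps)
    finally show ?thesis .
  qed
  define B where "B = 4 powr q * real d powr (q / 2)"
  have B0: "0 \<le> B" by (simp add: B_def)
  \<comment> \<open>The constant is \<open>64 * 200\<close>: the 64 cancels the one in the target
    for the prior probability, and the 200 is the share of failure spread over the \<open>L\<close>
    levels. The crude bound \<open>ln x \<le> x\<close> is harmless, as \<open>L\<close> is itself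
    logarithmic.\<close>
  have lnL: "ln (12800 * real L) \<le> 51200 * \<Lambda>"
    using L0 ln_le_minus_one[of "12800 * real L"] LL by simp
  have lnL0: "0 \<le> ln (12800 * real L)" using L1 by simp
  have "s powr q * (1 / v + ln (12800 * real L))
      = 512 * (real d * (s powr q / s\<^sup>2)) * ln (128 / p) + s powr q * ln (12800 * real L)"
    by (simp add: vinv algebra_simps)
  also have "\<dots> \<le> 512 * B * ((2048 + 3 * q) * \<Lambda>) + B * (51200 * \<Lambda>)"
    using sq sq2 lnp lnp0 lnL lnL0 B0 q unfolding B_def[symmetric]
    by (intro add_mono mult_mono) auto
  also have "\<dots> = B * (512 * (2048 + 3 * q) + 51200) * \<Lambda>" by (simp add: algebra_simps)
  finally have 1: "s powr q * (1 / v + ln (12800 * real L)) \<le> B * (512 * (2048 + 3 * q) + 51200) * \<Lambda>" .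
  have "32 * real L * (s powr q * (1 / v + ln (12800 * real L)))
      \<le> 32 * (4 * \<Lambda>) * (B * (512 * (2048 + 3 * q) + 51200) * \<Lambda>)"
  proof (rule mult_mono[OF _ 1])
    have "0 \<le> 1 / v" unfolding vinv using lnp0 by simp
    then show "0 \<le> s powr q * (1 / v + ln (12800 * real L))"
      using lnL0 by (intro mult_nonneg_nonneg add_nonneg_nonneg) auto
  qed (use LL \<Lambda> in auto)
  also have "\<dots> = 128 * 4 powr q * (512 * (2048 + 3 * q) + 51200) * (real d powr (q / 2) * \<Lambda> ^ 2)"
    by (simp add: B_def power2_eq_square)
  also have "\<dots> \<le> real m" using m by (simp add: \<Lambda>_def sample_const_def)
  finally have "32 * real L * s powr q * (1 / v + ln (12800 * real L)) \<le> real m" by (simp add: mult.assoc)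
  then have "1 / v + ln (12800 * real L) \<le> real m / (32 * real L * s powr q)"
    using L0 spos by (simp add: pos_le_divide_eq mult.commute)
  also have "\<dots> = real m * p / 8" by (simp add: pdef)
  finally have key: "- (real m * p / 8) + 1 / v \<le> - ln (12800 * real L)" by simp
  have "exp a / (exp (- b) / 64) = 64 * exp (a + b)" for a b :: real
    by (simp only: exp_add exp_minus divide_inverse inverse_mult_distrib inverse_inverse_eq mult_ac)
  then have "exp (- (real m * p / 8)) / (exp (- (1 / v)) / 64) = 64 * exp (- (real m * p / 8) + 1 / v)" .
  also have "\<dots> \<le> 64 * exp (- ln (12800 * real L))" using key by simp
  also have "\<dots> = 1 / (200 * real L)" using L0 by (simp add: exp_minus inverse_eq_divide)
  finally show "exp (- (real m * p / 8)) / (exp (- (1 / v)) / 64) \<le> 1 / (200 * real L)" .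
qed

text \<open>Jensen's inequality with exponent \<open>2 / q\<close>. It places the coefficients of a
  function of unit \<open>L\<^sub>q\<close> norm in the Euclidean unit ball, the only place where
  bounded biases are required.\<close>

lemma pmf_L2_le_Lq:
  fixes P :: "'a pmf" and q :: real
  assumes fin: "finite (set_pmf P)" and q: "2 \<le> q"
  shows "(\<Sum>i\<in>set_pmf P. pmf P i * (z i)\<^sup>2) \<le> (\<Sum>i\<in>set_pmf P. pmf P i * \<bar>z i\<bar> powr q) powr (2 / q)"
proof -
  have "(\<Sum>i\<in>set_pmf P. pmf P i * (z i)\<^sup>2) = (\<Sum>i\<in>set_pmf P. pmf P i * (\<bar>z i\<bar> powr q) powr (2 / q))"
  proof (intro sum.cong refl)
    fix i
    have "(\<bar>z i\<bar> powr q) powr (2 / q) = \<bar>z i\<bar> powr 2" using q by (simp add: powr_powr)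
    then show "pmf P i * (z i)\<^sup>2 = pmf P i * (\<bar>z i\<bar> powr q) powr (2 / q)" by simp
  qed
  also have "\<dots> \<le> (\<Sum>i\<in>set_pmf P. pmf P i * \<bar>z i\<bar> powr q) powr (2 / q)"
    using fin q by (intro sum_powr_le_powr_sum) (auto simp: sum_pmf_eq_1)
  finally show ?thesis .
qed

lemma sampling_lower_bound:
  fixes P :: "'a pmf" and q :: real
  assumes q: "2 \<le> q" and d: "1 \<le> d" and fin: "finite (set_pmf P)"
    and on: "orthonormal_on (set_pmf P) (pmf P) r e"
    and eb: "\<And>i. i \<in> set_pmf P \<Longrightarrow> (\<Sum>k<r. (e k i)\<^sup>2) \<le> 4 * real d"
    and m: "sample_const q * (real d powr (q / 2) * log1 d ^ 2) \<le> real m"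
  shows "199 / 200 \<le> measure_pmf.prob (Pi_pmf {..<m} dflt (\<lambda>_. P))
     {S. \<forall>u. real m * (\<Sum>i\<in>set_pmf P. pmf P i * \<bar>\<Sum>k<r. u k * e k i\<bar> powr q)
            \<le> 32 * 4 powr q * (\<Sum>s<m. \<bar>\<Sum>k<r. u k * e k (S s)\<bar> powr q)}"
proof -
  let ?Q = "Pi_pmf {..<m} dflt (\<lambda>_. P)"
  define L where "L = nat \<lceil>log 2 (4 * sqrt (real d))\<rceil>"
  define p where "p = (\<lambda>l. 1 / (4 * real L * (2 ^ l) powr q))"
  define v where "v = (\<lambda>l :: nat. (2 ^ l / 2)\<^sup>2 / (32 * (4 * real d) * ln (128 / p l)))"
  have par: "0 < p l" "p l \<le> 1" "exp (- (real m * p l / 8)) / (exp (- (1 / v l)) / 64) \<le> 1 / (200 * real L)"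
    if "l < L" for l
    using level_parameters[OF q d _ m, of l] that unfolding p_def v_def L_def by auto
  have sd: "1 \<le> sqrt (real d)" using d by simp
  have lg: "log 2 4 \<le> log 2 (4 * sqrt (real d))" using sd d by (subst log_le_cancel_iff) auto
  have lg2: "log 2 4 = (2::real)" using log_powr_cancel[of 2 2] by simp
  have L0: "0 < L" unfolding L_def using lg lg2 by linarith
  \<comment> \<open>\<open>L\<close> is the number of levels after which the dyadic scale passes the
    sup norm bound for functions of unit \<open>L\<^sub>q\<close> norm.\<close>
  have Lbig: "2 * sqrt (real d) \<le> 2 ^ L / 2"
  proof -
    have "log 2 (4 * sqrt (real d)) \<le> real L" unfolding L_def by linarith
    then have "2 powr log 2 (4 * sqrt (real d)) \<le> 2 powr real L" by simp
    then show ?thesis using d by (simp add: powr_realpow)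
  qed
  define N where "N = (\<lambda>l. nat \<lceil>1 / v l\<rceil>)"
  have N: "1 / v l \<le> real (N l)" for l unfolding N_def by linarith
  \<comment> \<open>These events depend on \<open>S\<close> and the level alone, not on a
    coefficient vector; this makes the union bound one over \<open>L\<close> events.\<close>
  define Bad where "Bad l = {S. exp (- (1 / v l)) / 64 \<le> measure_pmf.prob (sign_prior r (N l))
      {\<omega>. missed P m S (p l) (3 / 4 * (2 ^ l / 2)) (sign_walk r (N l) (v l) e \<omega>)}}" for l :: nat
  have PBad: "measure_pmf.prob ?Q (Bad l) \<le> 1 / (200 * real L)" if "l < L" for l
    unfolding Bad_def
    by (rule order_trans[OF missed_prior_prob par(3)[OF that]]) (use fin in auto)
  define Good where "Good = {S. \<forall>u. real m * (\<Sum>i\<in>set_pmf P. pmf P i * \<bar>\<Sum>k<r. u k * e k i\<bar> powr q)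
            \<le> 32 * 4 powr q * (\<Sum>s<m. \<bar>\<Sum>k<r. u k * e k (S s)\<bar> powr q)}"
  have good: "S \<in> Good" if S: "S \<in> set_pmf ?Q" and nb: "\<And>l. l < L \<Longrightarrow> S \<notin> Bad l" for S
    unfolding Good_def
  proof (intro CollectI allI)
    fix u :: "nat \<Rightarrow> real"
    have SX: "S s \<in> set_pmf P" if "s < m" for s
      using S that set_Pi_pmf_subset'[of "{..<m}" dflt "\<lambda>_. P"] by (auto simp: PiE_dflt_def)
    define z where "z = (\<lambda>i. \<Sum>k<r. u k * e k i)"
    define F where "F = (\<Sum>i\<in>set_pmf P. pmf P i * \<bar>z i\<bar> powr q)"
    have F0: "0 \<le> F" unfolding F_def by (intro sum_nonneg) auto
    have "real m * F \<le> 32 * 4 powr q * (\<Sum>s<m. \<bar>z (S s)\<bar> powr q)"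
    proof (cases "F = 0")
      case True
      then show ?thesis by (auto intro!: mult_nonneg_nonneg sum_nonneg)
    next
      case False
      then have Fp: "0 < F" using F0 by simp
      \<comment> \<open>By homogeneity it suffices to treat functions of unit
        \<open>L\<^sub>q\<close> norm, for which the levels are fixed once and for all.\<close>
      define c where "c = F powr (1 / q)"
      have c0: "0 < c" using Fp by (simp add: c_def)
      have cq: "c powr q = F" using Fp q by (simp add: c_def powr_powr)
      define u' where "u' = (\<lambda>k. u k / c)"
      define z' where "z' = (\<lambda>i. \<Sum>k<r. u' k * e k i)"
      have z': "z' i = z i / c" for i by (simp add: z'_def u'_def z_def sum_divide_distrib)
      have norm': "(\<Sum>i\<in>set_pmf P. pmf P i * \<bar>z' i\<bar> powr q) = 1"
        using c0 Fp by (simp add: z' abs_divide powr_divide cq sum_divide_distrib[symmetric] F_def[symmetric])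
      have u1: "(\<Sum>k<r. (u' k)\<^sup>2) \<le> 1"
      proof -
        have "(\<Sum>k<r. (u' k)\<^sup>2) = (\<Sum>i\<in>set_pmf P. pmf P i * (z' i)\<^sup>2)"
          unfolding z'_def by (rule orthonormal_parseval[OF on, symmetric])
        also have "\<dots> \<le> 1 powr (2 / q)" unfolding norm'[symmetric] by (rule pmf_L2_le_Lq[OF fin q])
        finally show ?thesis by simp
      qed
      have zb: "\<bar>z' i\<bar> \<le> 2 ^ L / 2" if i: "i \<in> set_pmf P" for i
      proof -
        have "(z' i)\<^sup>2 \<le> (\<Sum>k<r. (u' k)\<^sup>2) * (\<Sum>k<r. (e k i)\<^sup>2)"
          unfolding z'_def by (rule Cauchy_Schwarz_ineq_sum)
        also have "\<dots> \<le> 1 * (4 * real d)" using u1 eb[OF i] by (intro mult_mono) (auto intro: sum_nonneg)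
        also have "\<dots> = (2 * sqrt (real d))\<^sup>2" by (simp add: power_mult_distrib)
        finally have "\<bar>z' i\<bar> \<le> \<bar>2 * sqrt (real d)\<bar>" by (simp only: abs_le_square_iff)
        then have "\<bar>z' i\<bar> \<le> 2 * sqrt (real d)" by simp
        then show ?thesis using Lbig by linarith
      qed
      have "real m \<le> 32 * 4 powr q * (\<Sum>s<m. \<bar>z' (S s)\<bar> powr q)"
      proof (rule empirical_bound_from_levels[OF fin q L0 zb norm'])
        fix l assume l: "l < L"
          and heavy: "1 / (4 * real L * (2 ^ l) powr q) \<le> measure_pmf.prob P {i. 2 ^ l / 2 < \<bar>z' i\<bar>}"
        show "5 / 32 * (real m * measure_pmf.prob P {i. 2 ^ l / 2 < \<bar>z' i\<bar>}) \<le> hits m S {i. 2 ^ l / 2 / 2 < \<bar>z' i\<bar>}"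
        proof (rule level_mass_preserved[OF fin eb _ _ par(1)[OF l] par(2)[OF l] _ N u1 z'_def SX])
          show "v l = (2 ^ l / 2)\<^sup>2 / (32 * (4 * real d) * ln (128 / p l))" by (simp add: v_def)
          show "p l \<le> measure_pmf.prob P {i. 2 ^ l / 2 < \<bar>z' i\<bar>}" using heavy by (simp add: p_def)
          show "measure_pmf.prob (sign_prior r (N l))
             {\<omega>. missed P m S (p l) (3 / 4 * (2 ^ l / 2)) (sign_walk r (N l) (v l) e \<omega>)} \<le> exp (- (1 / v l)) / 64"
            using nb[OF l] unfolding Bad_def by (simp add: not_le)
        qed (use d in auto)
      qed auto
      also have "(\<Sum>s<m. \<bar>z' (S s)\<bar> powr q) = (\<Sum>s<m. \<bar>z (S s)\<bar> powr q) / F"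
        using c0 by (simp add: z' abs_divide powr_divide cq sum_divide_distrib)
      finally show ?thesis using Fp by (simp add: field_simps)
    qed
    then show "real m * (\<Sum>i\<in>set_pmf P. pmf P i * \<bar>\<Sum>k<r. u k * e k i\<bar> powr q)
            \<le> 32 * 4 powr q * (\<Sum>s<m. \<bar>\<Sum>k<r. u k * e k (S s)\<bar> powr q)"
      by (simp add: F_def z_def)
  qed
  have "1 = measure_pmf.prob ?Q UNIV" by simp
  also have "\<dots> \<le> measure_pmf.prob ?Q (Good \<union> (\<Union>l<L. Bad l))"
    using good by (intro measure_pmf.finite_measure_mono_AE AE_pmfI) auto
  also have "\<dots> \<le> measure_pmf.prob ?Q Good + measure_pmf.prob ?Q (\<Union>l<L. Bad l)"
    by (rule measure_Un_le) auto
  also have "measure_pmf.prob ?Q (\<Union>l<L. Bad l) \<le> (\<Sum>l<L. measure_pmf.prob ?Q (Bad l))"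
    by (rule measure_UNION_le) auto
  also have "\<dots> \<le> (\<Sum>l<L. 1 / (200 * real L))" by (intro sum_mono PBad) auto
  also have "\<dots> = 1 / 200" using L0 by simp
  finally show ?thesis unfolding Good_def by simp
qed

section \<open>Regression\<close>

lemma pmf_of_weights:
  fixes w :: "'a \<Rightarrow> real"
  assumes "finite X" "\<And>i. i \<in> X \<Longrightarrow> 0 < w i" "(\<Sum>i\<in>X. w i) = 1"
  shows "\<exists>P. set_pmf P = X \<and> (\<forall>i\<in>X. pmf P i = w i)"
proof -
  define g where "g = (\<lambda>i. if i \<in> X then w i else 0)"
  have g0: "0 \<le> g i" for i using assms(2) by (simp add: g_def less_imp_le)
  have "(\<integral>\<^sup>+ i. ennreal (g i) \<partial>count_space UNIV) = (\<Sum>i\<in>X. ennreal (g i))"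
    using assms(1) by (intro nn_integral_count_space') (auto simp: g_def)
  also have "\<dots> = ennreal (\<Sum>i\<in>X. g i)" using g0 by (intro sum_ennreal) auto
  also have "(\<Sum>i\<in>X. g i) = 1" using assms(3) by (simp add: g_def)
  finally have one: "(\<integral>\<^sup>+ i. ennreal (g i) \<partial>count_space UNIV) = 1" by simp
  have pm: "pmf (embed_pmf g) i = g i" for i by (rule pmf_embed_pmf[OF g0 one])
  have "i \<in> set_pmf (embed_pmf g) \<longleftrightarrow> i \<in> X" for i
    unfolding set_pmf_iff pm by (cases "i \<in> X") (use assms(2)[of i] in \<open>auto simp: g_def\<close>)
  then have "set_pmf (embed_pmf g) = X" by auto
  moreover have "\<forall>i\<in>X. pmf (embed_pmf g) i = w i" unfolding pm by (simp add: g_def)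
  ultimately show ?thesis by blast
qed

text \<open>The Lewis exponent \<open>1 - 2 / p\<close> is the one for which the change of density
  turns \<open>w powr \<theta> * y\<^sup>2\<close> into a multiple of
  \<open>pmf P * z\<^sup>2\<close>. The Lewis inequality thus becomes a sup norm bound in
  \<open>L\<^sub>2(P)\<close>.\<close>

lemma lewis_basis:
  fixes f :: "nat \<Rightarrow> 'a \<Rightarrow> real" and p :: real
  assumes fin: "finite X" and ne: "X \<noteq> {}" and d: "1 \<le> d" and p: "2 \<le> p"
  shows "\<exists>P r e. set_pmf P = X \<and> orthonormal_on X (pmf P) r e \<and>
     (\<forall>i\<in>X. (\<Sum>k<r. (e k i)\<^sup>2) \<le> 4 * real d) \<and>
     (\<forall>c. \<exists>u. \<forall>i\<in>X. (\<Sum>j<d. c j * f j i) / pmf P i powr (1 / p) = (\<Sum>k<r. u k * e k i))"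
proof -
  define \<theta> where "\<theta> = 1 - 2 / p"
  have \<theta>: "0 \<le> \<theta>" "\<theta> \<le> 1" "1 - \<theta> = 2 / p" using p by (auto simp: \<theta>_def)
  obtain w where w: "\<forall>i\<in>X. 0 < w i" "(\<Sum>i\<in>X. w i) \<le> 2 * real d"
    and lew: "\<forall>y\<in>lin_span X d f. \<forall>i\<in>X. (y i)\<^sup>2 \<le> 2 * w i powr (1 - \<theta>) * (\<Sum>j\<in>X. w j powr \<theta> * (y j)\<^sup>2)"
    using lewis_weights[OF fin ne d \<theta>(1,2), of f] by blast
  define W where "W = (\<Sum>i\<in>X. w i)"
  have W: "0 < W" unfolding W_def using fin ne w by (intro sum_pos) auto
  have "(\<Sum>i\<in>X. w i / W) = 1" using W by (simp add: sum_divide_distrib[symmetric] W_def[symmetric])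
  then obtain P where PX: "set_pmf P = X" and P: "\<forall>i\<in>X. pmf P i = w i / W"
    using pmf_of_weights[of X "\<lambda>i. w i / W"] fin w W by auto
  have Ppos: "0 < pmf P i" if "i \<in> X" for i using that PX by (simp add: pmf_positive)
  define g where "g = (\<lambda>j i. f j i / pmf P i powr (1 / p))"
  obtain r e where on: "orthonormal_on X (pmf P) r e" and sp: "lin_span X r e = lin_span X d g"
    using gram_schmidt[of X "pmf P" d g] fin Ppos by auto
  have sup: "(z i)\<^sup>2 \<le> 4 * real d * (\<Sum>j\<in>X. pmf P j * (z j)\<^sup>2)"
    if z: "z \<in> lin_span X d g" and i: "i \<in> X" for z i
  proof -
    define y where "y = (\<lambda>i. pmf P i powr (1 / p) * z i)"
    have "y \<in> lin_span X d f"
    proof -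
      obtain c where "\<forall>i\<in>X. z i = (\<Sum>j<d. c j * g j i)" using z by (auto simp: lin_span_def)
      moreover have "pmf P i powr (1 / p) * (\<Sum>j<d. c j * g j i) = (\<Sum>j<d. c j * f j i)" if "i \<in> X" for i
        using Ppos[OF that] by (simp add: g_def sum_distrib_left)
      ultimately have "\<forall>i\<in>X. y i = (\<Sum>j<d. c j * f j i)" by (simp add: y_def)
      then show ?thesis by (auto simp: lin_span_def)
    qed
    then have "(y i)\<^sup>2 \<le> 2 * w i powr (2 / p) * (\<Sum>j\<in>X. w j powr \<theta> * (y j)\<^sup>2)"
      using lew i \<theta>(3) by auto
    also have "w i powr (2 / p) = W powr (2 / p) * pmf P i powr (2 / p)"
      using P i W w by (simp add: powr_divide)
    also have "(\<Sum>j\<in>X. w j powr \<theta> * (y j)\<^sup>2) = (\<Sum>j\<in>X. W powr \<theta> * (pmf P j * (z j)\<^sup>2))"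
    proof (intro sum.cong refl)
      fix j assume j: "j \<in> X"
      have "w j = W * pmf P j" using P j W by simp
      then have "w j powr \<theta> * (y j)\<^sup>2 = W powr \<theta> * (pmf P j powr \<theta> * (pmf P j powr (1 / p))\<^sup>2) * (z j)\<^sup>2"
        using W by (simp add: powr_mult y_def power_mult_distrib)
      also have "pmf P j powr \<theta> * (pmf P j powr (1 / p))\<^sup>2 = pmf P j powr (\<theta> + (1 / p + 1 / p))"
        by (simp only: powr_add power2_eq_square)
      also have "\<theta> + (1 / p + 1 / p) = 1" by (simp add: \<theta>_def)
      also have "pmf P j powr 1 = pmf P j" by simp
      finally show "w j powr \<theta> * (y j)\<^sup>2 = W powr \<theta> * (pmf P j * (z j)\<^sup>2)" by (simp add: mult.assoc)
    qed
    also have "2 * (W powr (2 / p) * pmf P i powr (2 / p)) * (\<Sum>j\<in>X. W powr \<theta> * (pmf P j * (z j)\<^sup>2))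
       = pmf P i powr (2 / p) * (2 * (W powr (2 / p) * W powr \<theta>) * (\<Sum>j\<in>X. pmf P j * (z j)\<^sup>2))"
      by (simp add: sum_distrib_left mult_ac)
    also have "W powr (2 / p) * W powr \<theta> = W" using W by (simp add: powr_add[symmetric] \<theta>_def)
    also have "(y i)\<^sup>2 = pmf P i powr (2 / p) * (z i)\<^sup>2"
    proof -
      have "(pmf P i powr (1 / p))\<^sup>2 = pmf P i powr (1 / p + 1 / p)" by (simp only: powr_add power2_eq_square)
      then show ?thesis by (simp add: y_def power_mult_distrib)
    qed
    finally have "(z i)\<^sup>2 \<le> 2 * W * (\<Sum>j\<in>X. pmf P j * (z j)\<^sup>2)"
      using Ppos[OF i] by (subst (asm) mult_le_cancel_left_pos) auto
    also have "\<dots> \<le> 4 * real d * (\<Sum>j\<in>X. pmf P j * (z j)\<^sup>2)"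
      using w(2) by (intro mult_right_mono sum_nonneg) (auto simp: W_def)
    finally show ?thesis .
  qed
  have eb: "(\<Sum>k<r. (e k i)\<^sup>2) \<le> 4 * real d" if i: "i \<in> X" for i
  proof -
    define K where "K = (\<Sum>k<r. (e k i)\<^sup>2)"
    have K0: "0 \<le> K" unfolding K_def by (intro sum_nonneg) auto
    \<comment> \<open>The reproducing kernel at \<open>i\<close> has value \<open>K\<close> at
      \<open>i\<close> and also squared norm \<open>K\<close>, so the sup norm bound applied to it
      reads \<open>K\<^sup>2 \<le> 4 * d * K\<close>.\<close>
    have "(\<lambda>l. \<Sum>k<r. e k i * e k l) \<in> lin_span X d g"
      unfolding sp[symmetric] by (rule lin_span_sum) (rule lin_span_base)
    from sup[OF this i] have "K\<^sup>2 \<le> 4 * real d * (\<Sum>j\<in>X. pmf P j * (\<Sum>k<r. e k i * e k j)\<^sup>2)"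
      by (simp add: K_def power2_eq_square)
    also have "(\<Sum>j\<in>X. pmf P j * (\<Sum>k<r. e k i * e k j)\<^sup>2) = K"
      unfolding K_def by (rule orthonormal_parseval[OF on])
    finally have "K * K \<le> 4 * real d * K" by (simp add: power2_eq_square)
    then have "K \<le> 4 * real d" using K0 by (cases "K = 0") (auto simp: mult_le_cancel_right)
    then show ?thesis by (simp add: K_def)
  qed
  have rep: "\<exists>u. \<forall>i\<in>X. (\<Sum>j<d. c j * f j i) / pmf P i powr (1 / p) = (\<Sum>k<r. u k * e k i)" for c
  proof -
    have "(\<lambda>i. (\<Sum>j<d. c j * f j i) / pmf P i powr (1 / p)) \<in> lin_span X d g"
      by (auto simp: lin_span_def g_def sum_divide_distrib)
    then show ?thesis unfolding sp[symmetric] by (simp add: lin_span_def)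
  qed
  show ?thesis using PX on eb rep by (intro exI[of _ P] exI[of _ r] exI[of _ e]) auto
qed

text \<open>The slack factor 2 makes any point close enough to a positive infimum acceptable, so
  compactness is avoided. The lemma serves both the sampled problem and the choice of a comparison
  point for the true one.\<close>

lemma near_minimizer:
  fixes f :: "nat \<Rightarrow> 'a \<Rightarrow> real" and q :: real
  assumes fin: "finite X" and q: "0 < q"
  shows "\<exists>c. \<forall>c'. (\<Sum>i\<in>X. \<bar>(\<Sum>j<d. c j * f j i) - b i\<bar> powr q) \<le> 2 * (\<Sum>i\<in>X. \<bar>(\<Sum>j<d. c' j * f j i) - b i\<bar> powr q)"
proof -
  define \<phi> where "\<phi> c = (\<Sum>i\<in>X. \<bar>(\<Sum>j<d. c j * f j i) - b i\<bar> powr q)" for c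
  have \<phi>0: "0 \<le> \<phi> c" for c unfolding \<phi>_def by (intro sum_nonneg) auto
  have bdd: "bdd_below (range \<phi>)" using \<phi>0 by (intro bdd_belowI[of _ 0]) auto
  define \<mu> where "\<mu> = (INF c. \<phi> c)"
  have \<mu>le: "\<mu> \<le> \<phi> c" for c unfolding \<mu>_def by (intro cINF_lower bdd) auto
  have \<mu>0: "0 \<le> \<mu>" unfolding \<mu>_def by (intro cINF_greatest \<phi>0) auto
  have approx: "\<exists>c. \<phi> c < a" if "\<mu> < a" for a
    using that bdd unfolding \<mu>_def by (subst (asm) cINF_less_iff) auto
  have "\<exists>c. \<forall>c'. \<phi> c \<le> 2 * \<phi> c'"
  proof (cases "0 < \<mu>")
    case True
    then obtain c where "\<phi> c < 2 * \<mu>" using approx[of "2 * \<mu>"] by auto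
    then have "\<phi> c \<le> 2 * \<phi> c'" for c' using \<mu>le[of c'] by linarith
    then show ?thesis by blast
  next
    case False
    \<comment> \<open>An infimum of 0 is attained, since the residual of the orthogonal projection of \<open>b\<close> must vanish.\<close>
    then have \<mu>: "\<mu> = 0" using \<mu>0 by simp
    obtain r e where on: "orthonormal_on X (\<lambda>_. 1) r e" and sp: "lin_span X r e = lin_span X d f"
      using gram_schmidt[of X "\<lambda>_. 1" d f] fin by auto
    define a where "a k = (\<Sum>i\<in>X. b i * e k i)" for k
    define \<rho> where "\<rho> i = b i - (\<Sum>k<r. a k * e k i)" for i
    have orth: "(\<Sum>i\<in>X. \<rho> i * e l i) = 0" if "l < r" for l
    proof -
      have "(\<Sum>i\<in>X. \<rho> i * e l i) = a l - (\<Sum>i\<in>X. 1 * (\<Sum>k<r. a k * e k i) * e l i)"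
        by (simp add: \<rho>_def a_def left_diff_distrib sum_subtractf)
      then show ?thesis unfolding orthonormal_coeff[OF on that] by simp
    qed
    define R where "R = (\<Sum>i\<in>X. (\<rho> i)\<^sup>2)"
    have R0: "0 \<le> R" unfolding R_def by (intro sum_nonneg) auto
    have pyth: "R \<le> (\<Sum>i\<in>X. ((\<Sum>j<d. c j * f j i) - b i)\<^sup>2)" for c
    proof -
      have "(\<lambda>i. \<Sum>j<d. c j * f j i) \<in> lin_span X r e" unfolding sp by (auto simp: lin_span_def)
      then obtain u where u: "\<forall>i\<in>X. (\<Sum>j<d. c j * f j i) = (\<Sum>k<r. u k * e k i)" by (auto simp: lin_span_def)
      define h where "h i = (\<Sum>k<r. (u k - a k) * e k i)" for i
      have cross: "(\<Sum>i\<in>X. h i * \<rho> i) = 0"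
      proof -
        have "(\<Sum>i\<in>X. h i * \<rho> i) = (\<Sum>i\<in>X. \<Sum>k<r. (u k - a k) * (\<rho> i * e k i))"
          unfolding h_def sum_distrib_right by (simp add: mult_ac)
        also have "\<dots> = (\<Sum>k<r. (u k - a k) * (\<Sum>i\<in>X. \<rho> i * e k i))"
          by (subst sum.swap) (simp add: sum_distrib_left)
        also have "\<dots> = 0" using orth by (intro sum.neutral) simp
        finally show ?thesis .
      qed
      have "(\<Sum>i\<in>X. ((\<Sum>j<d. c j * f j i) - b i)\<^sup>2) = (\<Sum>i\<in>X. (h i)\<^sup>2 + (\<rho> i)\<^sup>2 - 2 * (h i * \<rho> i))"
      proof (intro sum.cong refl)
        fix i assume "i \<in> X"
        then have "(\<Sum>j<d. c j * f j i) - b i = h i - \<rho> i"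
          using u by (simp add: h_def \<rho>_def left_diff_distrib sum_subtractf)
        then show "((\<Sum>j<d. c j * f j i) - b i)\<^sup>2 = (h i)\<^sup>2 + (\<rho> i)\<^sup>2 - 2 * (h i * \<rho> i)"
          by (simp add: power2_diff mult.assoc)
      qed
      also have "\<dots> = (\<Sum>i\<in>X. (h i)\<^sup>2) + R - 2 * (\<Sum>i\<in>X. h i * \<rho> i)"
        by (simp add: R_def sum.distrib sum_subtractf sum_distrib_left)
      also have "\<dots> \<ge> R" unfolding cross by (simp add: sum_nonneg)
      finally show ?thesis .
    qed
    have "R = 0"
    proof (rule ccontr)
      assume "R \<noteq> 0"
      then have Rp: "0 < R" using R0 by simp
      define n where "n = real (card X)"
      have n: "0 < n"
        using Rp fin unfolding n_def R_def by (metis card_gt_0_iff less_irrefl of_nat_0_less_iff sum.empty)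
      \<comment> \<open>If every squared residual is at most this \<open>\<epsilon>\<close>, their
        sum is at most \<open>R / 2\<close>, below the minimum \<open>R\<close> of the least squares
        problem.\<close>
      define \<epsilon> where "\<epsilon> = R / (2 * n)"
      have \<epsilon>: "0 < \<epsilon>" using Rp n by (simp add: \<epsilon>_def)
      obtain c where c: "\<phi> c < \<epsilon> powr (q / 2)" using approx[of "\<epsilon> powr (q / 2)"] \<epsilon> \<mu> by auto
      have "((\<Sum>j<d. c j * f j i) - b i)\<^sup>2 \<le> \<epsilon>" if i: "i \<in> X" for i
      proof -
        let ?t = "\<bar>(\<Sum>j<d. c j * f j i) - b i\<bar>"
        have "?t powr q \<le> \<phi> c" unfolding \<phi>_def using fin i by (intro member_le_sum) auto
        then have "(?t powr q) powr (2 / q) \<le> (\<epsilon> powr (q / 2)) powr (2 / q)"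
          using c q by (intro powr_mono2) auto
        moreover have "(?t powr q) powr (2 / q) = ?t powr 2" using q by (simp add: powr_powr)
        moreover have "(\<epsilon> powr (q / 2)) powr (2 / q) = \<epsilon>" using q \<epsilon> by (simp add: powr_powr)
        ultimately show ?thesis by simp
      qed
      then have "(\<Sum>i\<in>X. ((\<Sum>j<d. c j * f j i) - b i)\<^sup>2) \<le> (\<Sum>i\<in>X. \<epsilon>)" by (rule sum_mono)
      also have "\<dots> = R / 2" using n by (simp add: \<epsilon>_def n_def)
      finally show False using pyth[of c] Rp by linarith
    qed
    then have \<rho>0: "\<forall>i\<in>X. \<rho> i = 0" unfolding R_def using fin by (subst (asm) sum_nonneg_eq_0_iff) auto
    have "(\<lambda>i. \<Sum>k<r. a k * e k i) \<in> lin_span X d f"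
      unfolding sp[symmetric] by (rule lin_span_sum) (rule lin_span_base)
    then obtain c where "\<forall>i\<in>X. (\<Sum>k<r. a k * e k i) = (\<Sum>j<d. c j * f j i)" by (auto simp: lin_span_def)
    then have "\<phi> c = 0" unfolding \<phi>_def using \<rho>0 by (intro sum.neutral) (auto simp: \<rho>_def)
    then show ?thesis using \<phi>0 by (intro exI[of _ c]) auto
  qed
  then show ?thesis unfolding \<phi>_def .
qed

text \<open>The strict inequality in the event allows \<open>B = 0\<close>, which occurs when
  \<open>b\<close> lies in the column space: then \<open>f\<close> vanishes on the support.\<close>

lemma pmf_Markov_scaled:
  fixes f :: "'a \<Rightarrow> real"
  assumes int: "integrable (measure_pmf M) f" and f0: "\<And>x. x \<in> set_pmf M \<Longrightarrow> 0 \<le> f x"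
    and E: "measure_pmf.expectation M f \<le> B" and K: "0 < K"
  shows "measure_pmf.prob M {x. K * B < f x} \<le> 1 / K"
proof -
  have E0: "0 \<le> measure_pmf.expectation M f" by (intro integral_nonneg_AE AE_pmfI f0)
  show ?thesis
  proof (cases "B = 0")
    case True
    then have "measure_pmf.expectation M f = 0" using E E0 by simp
    then have "AE x in M. f x = 0"
      using int f0 by (subst (asm) integral_nonneg_eq_0_iff_AE) (auto intro: AE_pmfI)
    then have "\<forall>x\<in>set_pmf M. f x = 0" by (simp add: AE_measure_pmf_iff)
    then have "measure_pmf.prob M {x. K * B < f x} = 0"
      unfolding measure_pmf_zero_iff using True by auto
    then show ?thesis using K by simp
  next
    case False
    then have B: "0 < B" using E E0 by simp
    have "measure_pmf.prob M {x. K * B < f x} \<le> measure_pmf.prob M {x. K * B \<le> f x}"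
      by (intro measure_pmf.finite_measure_mono) auto
    also have "\<dots> \<le> measure_pmf.expectation M f / (K * B)" using B K by (intro pmf_Markov int f0) auto
    also have "\<dots> \<le> B / (K * B)" using E B K by (intro divide_right_mono) auto
    finally show ?thesis using B by simp
  qed
qed

lemma abs_add_powr_le:
  fixes x y q :: real
  assumes "0 \<le> q"
  shows "\<bar>x + y\<bar> powr q \<le> 2 powr q * (\<bar>x\<bar> powr q + \<bar>y\<bar> powr q)"
proof -
  have "\<bar>x + y\<bar> powr q \<le> (2 * max \<bar>x\<bar> \<bar>y\<bar>) powr q" using assms by (intro powr_mono2) auto
  also have "\<dots> = 2 powr q * (max \<bar>x\<bar> \<bar>y\<bar>) powr q" by (simp add: powr_mult)
  also have "(max \<bar>x\<bar> \<bar>y\<bar>) powr q \<le> \<bar>x\<bar> powr q + \<bar>y\<bar> powr q" by (simp add: max_def)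
  finally show ?thesis by simp
qed

text \<open>Interpolation: \<open>p - q\<close> of the powers of \<open>z\<close> are bounded by its
  sup norm, itself at most \<open>2 * sqrt d\<close> times the \<open>L\<^sub>q\<close> norm by
  Cauchy-Schwarz and \<open>pmf_L2_le_Lq\<close>.\<close>

lemma Lp_le_Lq_of_orthonormal:
  fixes P :: "'a pmf" and p q :: real
  assumes q: "2 \<le> q" "q < p" and fin: "finite (set_pmf P)"
    and on: "orthonormal_on (set_pmf P) (pmf P) r e"
    and eb: "\<And>i. i \<in> set_pmf P \<Longrightarrow> (\<Sum>k<r. (e k i)\<^sup>2) \<le> 4 * real d"
    and z: "\<And>i. i \<in> set_pmf P \<Longrightarrow> z i = (\<Sum>k<r. u k * e k i)"
  shows "(\<Sum>i\<in>set_pmf P. pmf P i * \<bar>z i\<bar> powr p)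
    \<le> 2 powr (p - q) * real d powr ((p - q) / 2) * (\<Sum>i\<in>set_pmf P. pmf P i * \<bar>z i\<bar> powr q) powr (p / q)"
proof -
  define F where "F = (\<Sum>i\<in>set_pmf P. pmf P i * \<bar>z i\<bar> powr q)"
  have F0: "0 \<le> F" unfolding F_def by (intro sum_nonneg) auto
  have u2: "(\<Sum>k<r. (u k)\<^sup>2) \<le> F powr (2 / q)"
  proof -
    have "(\<Sum>k<r. (u k)\<^sup>2) = (\<Sum>i\<in>set_pmf P. pmf P i * (\<Sum>k<r. u k * e k i)\<^sup>2)"
      by (rule orthonormal_parseval[OF on, symmetric])
    also have "\<dots> = (\<Sum>i\<in>set_pmf P. pmf P i * (z i)\<^sup>2)" using z by (intro sum.cong) auto
    also have "\<dots> \<le> F powr (2 / q)" unfolding F_def by (rule pmf_L2_le_Lq[OF fin q(1)])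
    finally show ?thesis .
  qed
  have sup: "\<bar>z i\<bar> \<le> 2 * sqrt (real d) * F powr (1 / q)" if i: "i \<in> set_pmf P" for i
  proof -
    have "(z i)\<^sup>2 \<le> (\<Sum>k<r. (u k)\<^sup>2) * (\<Sum>k<r. (e k i)\<^sup>2)"
      unfolding z[OF i] by (rule Cauchy_Schwarz_ineq_sum)
    also have "\<dots> \<le> F powr (2 / q) * (4 * real d)"
      using u2 eb[OF i] by (intro mult_mono) (auto intro: sum_nonneg)
    also have "F powr (2 / q) = (F powr (1 / q))\<^sup>2"
      by (simp add: power2_eq_square powr_add[symmetric])
    also have "(F powr (1 / q))\<^sup>2 * (4 * real d) = (2 * sqrt (real d) * F powr (1 / q))\<^sup>2"
      by (simp add: power_mult_distrib)
    finally have "\<bar>z i\<bar> \<le> \<bar>2 * sqrt (real d) * F powr (1 / q)\<bar>" by (simp only: abs_le_square_iff)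
    then show ?thesis by simp
  qed
  have "(\<Sum>i\<in>set_pmf P. pmf P i * \<bar>z i\<bar> powr p)
     = (\<Sum>i\<in>set_pmf P. \<bar>z i\<bar> powr (p - q) * (pmf P i * \<bar>z i\<bar> powr q))"
  proof (intro sum.cong refl)
    fix i
    have "\<bar>z i\<bar> powr p = \<bar>z i\<bar> powr (p - q) * \<bar>z i\<bar> powr q" by (simp add: powr_add[symmetric])
    then show "pmf P i * \<bar>z i\<bar> powr p = \<bar>z i\<bar> powr (p - q) * (pmf P i * \<bar>z i\<bar> powr q)"
      by (simp add: mult_ac)
  qed
  also have "\<dots> \<le> (\<Sum>i\<in>set_pmf P. (2 * sqrt (real d) * F powr (1 / q)) powr (p - q) * (pmf P i * \<bar>z i\<bar> powr q))"
    using q sup by (intro sum_mono mult_right_mono powr_mono2) auto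
  also have "\<dots> = (2 * sqrt (real d) * F powr (1 / q)) powr (p - q) * F"
    by (simp add: F_def sum_distrib_left)
  also have "(2 * sqrt (real d) * F powr (1 / q)) powr (p - q)
      = 2 powr (p - q) * real d powr ((p - q) / 2) * F powr ((p - q) / q)"
    by (simp add: powr_mult powr_half_sqrt[symmetric] powr_powr)
  also have "2 powr (p - q) * real d powr ((p - q) / 2) * F powr ((p - q) / q) * F
      = 2 powr (p - q) * real d powr ((p - q) / 2) * F powr (p / q)"
  proof -
    have "F powr ((p - q) / q) * F = F powr ((p - q) / q) * F powr 1" using F0 by simp
    also have "\<dots> = F powr (p / q)" using q by (simp only: powr_add[symmetric]) (simp add: field_simps)
    finally show ?thesis by simp
  qed
  finally show ?thesis by (simp add: F_def)
qed

text \<open>The factor \<open>2 powr p\<close> and the \<open>1\<close> come from splitting the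
  final residual, \<open>2 powr (p - q)\<close> from interpolation, \<open>32 * 4 powr q\<close>
  from sampling, \<open>2 powr q\<close> from splitting the sampled residual, and \<open>600\<close>
  from Markov's 200 times 3 for the residual at \<open>x\<close> and the near-minimal one.\<close>

definition approx_const :: "real \<Rightarrow> real \<Rightarrow> real" where
  "approx_const p q = 2 powr p * (2 powr (p - q) * (32 * 4 powr q * (2 powr q * 600)) powr (p / q) + 1)"

lemma approx_const_pos: "0 < approx_const p q"
  unfolding approx_const_def by (intro mult_pos_pos add_nonneg_pos) auto

text \<open>\<open>P\<close> is fixed before \<open>b\<close> and the comparison point
  \<open>x\<close>, as queries must not depend on \<open>b\<close>. The good event covers every
  near-minimizer \<open>c\<close> at once, since the solution depends on the sample.\<close>

lemma regression_from_samples: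
  fixes f :: "nat \<Rightarrow> 'a \<Rightarrow> real" and p q :: real
  assumes fin: "finite X" and ne: "X \<noteq> {}" and d: "1 \<le> d" and q: "2 \<le> q" "q < p"
    and m: "sample_const q * (real d powr (q / 2) * log1 d ^ 2) \<le> real m"
    and m0: "0 < m"
  shows "\<exists>P. set_pmf P = X \<and> (\<forall>b x. 99 / 100 \<le> measure_pmf.prob (Pi_pmf {..<m} dflt (\<lambda>_. P))
    {S. \<forall>c. (\<forall>c'. (\<Sum>s<m. \<bar>(\<Sum>j<d. c j * (f j (S s) / pmf P (S s) powr (1 / p))) - b (S s) / pmf P (S s) powr (1 / p)\<bar> powr q)
        \<le> 2 * (\<Sum>s<m. \<bar>(\<Sum>j<d. c' j * (f j (S s) / pmf P (S s) powr (1 / p))) - b (S s) / pmf P (S s) powr (1 / p)\<bar> powr q))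
      \<longrightarrow> (\<Sum>i\<in>X. \<bar>(\<Sum>j<d. c j * f j i) - b i\<bar> powr p)
         \<le> approx_const p q * real d powr ((p - q) / 2) * (\<Sum>i\<in>X. \<bar>(\<Sum>j<d. x j * f j i) - b i\<bar> powr p)})"
proof -
  obtain P r e where PX: "set_pmf P = X" and on: "orthonormal_on X (pmf P) r e"
    and eb: "\<forall>i\<in>X. (\<Sum>k<r. (e k i)\<^sup>2) \<le> 4 * real d"
    and rep: "\<forall>c. \<exists>u. \<forall>i\<in>X. (\<Sum>j<d. c j * f j i) / pmf P i powr (1 / p) = (\<Sum>k<r. u k * e k i)"
    using lewis_basis[OF fin ne d, of p f] q by fastforce
  have Ppos: "0 < pmf P i" if "i \<in> X" for i using that PX by (simp add: pmf_positive)
  define \<rho> where "\<rho> i = pmf P i powr (1 / p)" for i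
  have \<rho>: "0 < \<rho> i" if "i \<in> X" for i using Ppos[OF that] by (simp add: \<rho>_def)
  have \<rho>p: "pmf P i * \<bar>y / \<rho> i\<bar> powr p = \<bar>y\<bar> powr p" if "i \<in> X" for i y
    using Ppos[OF that] q by (simp add: \<rho>_def abs_divide powr_divide powr_powr)
  let ?Q = "Pi_pmf {..<m} dflt (\<lambda>_. P)"
  have finQ: "finite (set_pmf ?Q)" using fin PX by (intro finite_set_Pi_pmf) auto
  define G1 where "G1 = {S. \<forall>u. real m * (\<Sum>i\<in>X. pmf P i * \<bar>\<Sum>k<r. u k * e k i\<bar> powr q)
            \<le> 32 * 4 powr q * (\<Sum>s<m. \<bar>\<Sum>k<r. u k * e k (S s)\<bar> powr q)}"
  have G1: "199 / 200 \<le> measure_pmf.prob ?Q G1"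
    unfolding G1_def using sampling_lower_bound[OF q(1) d, of P r e m dflt] fin on eb m by (simp add: PX)
  have "99 / 100 \<le> measure_pmf.prob ?Q
    {S. \<forall>c. (\<forall>c'. (\<Sum>s<m. \<bar>(\<Sum>j<d. c j * (f j (S s) / \<rho> (S s))) - b (S s) / \<rho> (S s)\<bar> powr q)
        \<le> 2 * (\<Sum>s<m. \<bar>(\<Sum>j<d. c' j * (f j (S s) / \<rho> (S s))) - b (S s) / \<rho> (S s)\<bar> powr q))
      \<longrightarrow> (\<Sum>i\<in>X. \<bar>(\<Sum>j<d. c j * f j i) - b i\<bar> powr p)
         \<le> approx_const p q * real d powr ((p - q) / 2) * (\<Sum>i\<in>X. \<bar>(\<Sum>j<d. x j * f j i) - b i\<bar> powr p)}"
    (is "_ \<le> measure_pmf.prob ?Q ?G") for b x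
  proof -
    define res where "res c i = (\<Sum>j<d. c j * f j i) - b i" for c i
    define R where "R = (\<Sum>i\<in>X. \<bar>res x i\<bar> powr p)"
    have R0: "0 \<le> R" unfolding R_def by (intro sum_nonneg) auto
    define Z where "Z c S = (\<Sum>s<m. \<bar>res c (S s) / \<rho> (S s)\<bar> powr q)" for c and S :: "nat \<Rightarrow> 'a"
    have Z0: "0 \<le> Z c S" for c S unfolding Z_def by (intro sum_nonneg) auto
    \<comment> \<open>The residual at \<open>x\<close> need not lie in the span, so no sup norm
      bound is available; Jensen's inequality with exponent \<open>q / p\<close> suffices because
      only an upper bound on average is wanted.\<close>
    have Lq: "(\<Sum>i\<in>X. pmf P i * \<bar>res x i / \<rho> i\<bar> powr q) \<le> R powr (q / p)"
    proof -
      have "(\<Sum>i\<in>X. pmf P i * \<bar>res x i / \<rho> i\<bar> powr q)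
         = (\<Sum>i\<in>X. pmf P i * (\<bar>res x i / \<rho> i\<bar> powr p) powr (q / p))"
        using q by (simp add: powr_powr)
      also have "\<dots> \<le> (\<Sum>i\<in>X. pmf P i * \<bar>res x i / \<rho> i\<bar> powr p) powr (q / p)"
        using q fin PX by (intro sum_powr_le_powr_sum) (auto simp: sum_pmf_eq_1)
      also have "(\<Sum>i\<in>X. pmf P i * \<bar>res x i / \<rho> i\<bar> powr p) = R"
        unfolding R_def by (intro sum.cong refl \<rho>p)
      finally show ?thesis .
    qed
    have "measure_pmf.expectation ?Q (Z x) = (\<Sum>s<m. measure_pmf.expectation ?Q (\<lambda>S. \<bar>res x (S s) / \<rho> (S s)\<bar> powr q))"
      unfolding Z_def using finQ by (intro Bochner_Integration.integral_sum integrable_measure_pmf_finite)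
    also have "\<dots> = (\<Sum>s<m. \<Sum>i\<in>X. pmf P i * \<bar>res x i / \<rho> i\<bar> powr q)"
    proof (intro sum.cong refl)
      fix s assume "s \<in> {..<m}"
      then have "map_pmf (\<lambda>S. S s) ?Q = P" using Pi_pmf_component[of "{..<m}" s dflt "\<lambda>_. P"] by simp
      then have "measure_pmf.expectation ?Q (\<lambda>S. \<bar>res x (S s) / \<rho> (S s)\<bar> powr q)
         = measure_pmf.expectation P (\<lambda>i. \<bar>res x i / \<rho> i\<bar> powr q)"
        using integral_map_pmf[of "\<lambda>S. S s" ?Q "\<lambda>i. \<bar>res x i / \<rho> i\<bar> powr q"] by simp
      also have "\<dots> = (\<Sum>i\<in>X. pmf P i * \<bar>res x i / \<rho> i\<bar> powr q)"
        by (subst integral_measure_pmf_real[OF fin]) (auto simp: PX mult.commute)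
      finally show "measure_pmf.expectation ?Q (\<lambda>S. \<bar>res x (S s) / \<rho> (S s)\<bar> powr q)
         = (\<Sum>i\<in>X. pmf P i * \<bar>res x i / \<rho> i\<bar> powr q)" .
    qed
    also have "\<dots> \<le> real m * R powr (q / p)" using Lq by (simp add: mult_left_mono)
    finally have EZ: "measure_pmf.expectation ?Q (Z x) \<le> real m * R powr (q / p)" .
    define B2 where "B2 = {S. 200 * (real m * R powr (q / p)) < Z x S}"
    have B2: "measure_pmf.prob ?Q B2 \<le> 1 / 200"
      unfolding B2_def by (rule pmf_Markov_scaled[OF integrable_measure_pmf_finite[OF finQ] Z0 EZ]) simp
    have concl: "(\<Sum>i\<in>X. \<bar>res c i\<bar> powr p) \<le> approx_const p q * real d powr ((p - q) / 2) * R"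
      if S: "S \<in> set_pmf ?Q" "S \<in> G1" "S \<notin> B2" and c: "Z c S \<le> 2 * Z x S" for S c
    proof -
      have SX: "S s \<in> X" if "s < m" for s
        using S(1) that set_Pi_pmf_subset'[of "{..<m}" dflt "\<lambda>_. P"] PX by (auto simp: PiE_dflt_def)
      obtain u where u: "\<forall>i\<in>X. (\<Sum>j<d. (c j - x j) * f j i) / \<rho> i = (\<Sum>k<r. u k * e k i)"
        using rep unfolding \<rho>_def by meson
      \<comment> \<open>In the difference of two residuals \<open>b\<close> cancels, so
        \<open>z\<close> lies in the span and the uniform lower bound for the sampled norm
        applies.\<close>
      define z where "z i = (\<Sum>j<d. (c j - x j) * f j i) / \<rho> i" for i
      have zu: "z i = (\<Sum>k<r. u k * e k i)" if "i \<in> X" for i using u that by (simp add: z_def)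
      have zr: "z i = res c i / \<rho> i + - (res x i / \<rho> i)" for i
        by (simp add: z_def res_def left_diff_distrib sum_subtractf diff_divide_distrib)
      define F where "F = (\<Sum>i\<in>X. pmf P i * \<bar>z i\<bar> powr q)"
      have F0: "0 \<le> F" unfolding F_def by (intro sum_nonneg) auto
      have "real m * F = real m * (\<Sum>i\<in>X. pmf P i * \<bar>\<Sum>k<r. u k * e k i\<bar> powr q)"
        unfolding F_def using zu by simp
      also have "\<dots> \<le> 32 * 4 powr q * (\<Sum>s<m. \<bar>\<Sum>k<r. u k * e k (S s)\<bar> powr q)"
        using S(2) unfolding G1_def by blast
      also have "(\<Sum>s<m. \<bar>\<Sum>k<r. u k * e k (S s)\<bar> powr q) = (\<Sum>s<m. \<bar>z (S s)\<bar> powr q)"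
        using zu SX by simp
      also have "\<dots> \<le> (\<Sum>s<m. 2 powr q * (\<bar>res c (S s) / \<rho> (S s)\<bar> powr q + \<bar>- (res x (S s) / \<rho> (S s))\<bar> powr q))"
        unfolding zr using q by (intro sum_mono abs_add_powr_le) auto
      also have "\<dots> = 2 powr q * (Z c S + Z x S)"
        by (simp only: Z_def sum_distrib_left[symmetric] sum.distrib abs_minus_cancel)
      also have "\<dots> \<le> 2 powr q * (3 * (200 * (real m * R powr (q / p))))"
        using c S(3) by (intro mult_left_mono) (auto simp: B2_def)
      finally have "real m * F \<le> real m * ((32 * 4 powr q * (2 powr q * 600)) * R powr (q / p))"
        by (simp add: mult_ac)
      then have F: "F \<le> (32 * 4 powr q * (2 powr q * 600)) * R powr (q / p)"
        using m0 by (subst (asm) mult_le_cancel_left_pos) auto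
      have "(\<Sum>i\<in>X. pmf P i * \<bar>z i\<bar> powr p) \<le> 2 powr (p - q) * real d powr ((p - q) / 2) * F powr (p / q)"
        unfolding F_def PX[symmetric] using on eb zu fin
        by (intro Lp_le_Lq_of_orthonormal[OF q]) (auto simp: PX)
      also have "F powr (p / q) \<le> ((32 * 4 powr q * (2 powr q * 600)) * R powr (q / p)) powr (p / q)"
        using F F0 q by (intro powr_mono2) auto
      also have "\<dots> = (32 * 4 powr q * (2 powr q * 600)) powr (p / q) * R"
        using R0 q by (simp add: powr_mult powr_powr)
      finally have zp: "(\<Sum>i\<in>X. pmf P i * \<bar>z i\<bar> powr p)
         \<le> 2 powr (p - q) * real d powr ((p - q) / 2) * ((32 * 4 powr q * (2 powr q * 600)) powr (p / q) * R)"
        by (simp add: mult_left_mono)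
      have d1: "1 \<le> real d powr ((p - q) / 2)" using d q by (intro ge_one_powr_ge_zero) auto
      have "(\<Sum>i\<in>X. \<bar>res c i\<bar> powr p) \<le> (\<Sum>i\<in>X. 2 powr p * (pmf P i * \<bar>z i\<bar> powr p + \<bar>res x i\<bar> powr p))"
      proof (intro sum_mono)
        fix i assume i: "i \<in> X"
        have "res c i = z i * \<rho> i + res x i" using \<rho>[OF i] by (simp add: zr field_simps)
        then have "\<bar>res c i\<bar> powr p \<le> 2 powr p * (\<bar>z i * \<rho> i\<bar> powr p + \<bar>res x i\<bar> powr p)"
          using q by (simp only:) (intro abs_add_powr_le, simp)
        also have "\<bar>z i * \<rho> i\<bar> powr p = pmf P i * \<bar>z i\<bar> powr p"
          using \<rho>p[OF i, of "z i * \<rho> i"] \<rho>[OF i] by simp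
        finally show "\<bar>res c i\<bar> powr p \<le> 2 powr p * (pmf P i * \<bar>z i\<bar> powr p + \<bar>res x i\<bar> powr p)" .
      qed
      also have "\<dots> = 2 powr p * ((\<Sum>i\<in>X. pmf P i * \<bar>z i\<bar> powr p) + R)"
        by (simp only: sum_distrib_left[symmetric] sum.distrib R_def)
      also have "\<dots> \<le> 2 powr p * (2 powr (p - q) * real d powr ((p - q) / 2) * ((32 * 4 powr q * (2 powr q * 600)) powr (p / q) * R)
          + real d powr ((p - q) / 2) * R)"
        using zp mult_right_mono[OF d1 R0] by (intro mult_left_mono add_mono) auto
      also have "\<dots> = approx_const p q * real d powr ((p - q) / 2) * R"
        by (simp add: approx_const_def algebra_simps)
      finally show ?thesis .
    qed
    have in_G: "S \<in> ?G" if "S \<in> set_pmf ?Q" "S \<in> G1" "S \<notin> B2" for S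
    proof (intro CollectI allI impI)
      fix c assume "\<forall>c'. (\<Sum>s<m. \<bar>(\<Sum>j<d. c j * (f j (S s) / \<rho> (S s))) - b (S s) / \<rho> (S s)\<bar> powr q)
        \<le> 2 * (\<Sum>s<m. \<bar>(\<Sum>j<d. c' j * (f j (S s) / \<rho> (S s))) - b (S s) / \<rho> (S s)\<bar> powr q)"
      moreover have "Z c S = (\<Sum>s<m. \<bar>(\<Sum>j<d. c j * (f j (S s) / \<rho> (S s))) - b (S s) / \<rho> (S s)\<bar> powr q)" for c
        by (simp add: Z_def res_def diff_divide_distrib sum_divide_distrib)
      ultimately have "Z c S \<le> 2 * Z x S" by simp
      from concl[OF that this] show "(\<Sum>i\<in>X. \<bar>(\<Sum>j<d. c j * f j i) - b i\<bar> powr p)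
         \<le> approx_const p q * real d powr ((p - q) / 2) * (\<Sum>i\<in>X. \<bar>(\<Sum>j<d. x j * f j i) - b i\<bar> powr p)"
        by (simp only: res_def R_def)
    qed
    \<comment> \<open>The failures of the uniform lower bound and of Markov's inequality each take
      \<open>1 / 200\<close> of the allowed \<open>1 / 100\<close>.\<close>
    have "199 / 200 \<le> measure_pmf.prob ?Q (?G \<union> B2)"
      using in_G by (intro order_trans[OF G1] measure_pmf.finite_measure_mono_AE AE_pmfI) auto
    also have "\<dots> \<le> measure_pmf.prob ?Q ?G + measure_pmf.prob ?Q B2" by (rule measure_Un_le) auto
    finally show ?thesis using B2 by simp
  qed
  then show ?thesis using PX unfolding \<rho>_def by (intro exI[of _ P]) auto
qed

section \<open>Non-adaptive query trees and the algorithm\<close>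

text \<open>A non-adaptive tree: the indices are fixed in advance, and \<open>g\<close> receives the
  values in the order of reading, repeated reads included.\<close>

primrec query_list :: "nat list \<Rightarrow> (real list \<Rightarrow> 'r) \<Rightarrow> 'r query_tree" where
  "query_list [] g = Output (g [])"
| "query_list (i # is) g = Query i (\<lambda>v. query_list is (\<lambda>vs. g (v # vs)))"

lemma reads_query_list: "reads (query_list is g) b = is"
  by (induction "is" arbitrary: g) auto

lemma run_query_list: "run (query_list is g) b = g (map (($) b) is)"
  by (induction "is" arbitrary: g) auto

lemma lp_norm_mult_minus:
  fixes A :: "real mat"
  assumes "A \<in> carrier_mat n d" "b \<in> carrier_vec n" "x \<in> carrier_vec d"
  shows "lp_norm p (A *\<^sub>v x - b) = (\<Sum>i<n. \<bar>(\<Sum>j<d. x $ j * A $$ (i, j)) - b $ i\<bar> powr p) powr (1 / p)"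
proof -
  have "(A *\<^sub>v x - b) $ i = (\<Sum>j<d. x $ j * A $$ (i, j)) - b $ i" if "i < n" for i
    using assms that by (simp add: scalar_prod_def mult.commute atLeast0LessThan)
  then show ?thesis using assms by (simp add: lp_norm_def)
qed

lemma randomized_algorithm:
  fixes A :: "real mat" and p q :: real
  assumes q: "2 \<le> q" "q < p" and n: "1 \<le> n" and d: "1 \<le> d" and A: "A \<in> carrier_mat n d"
    and m: "sample_const q * (real d powr (q / 2) * log1 d ^ 2) \<le> real m"
    and m0: "0 < m"
  shows "\<exists>M :: real Matrix.vec query_tree pmf. \<forall>b \<in> carrier_vec n.
     (\<forall>T \<in> set_pmf M. set (reads T b) \<subseteq> {..<n} \<and> length (reads T b) = m \<and> run T b \<in> carrier_vec d) \<and>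
     99 / 100 \<le> measure_pmf.prob M {T. lp_norm p (A *\<^sub>v run T b - b)
        \<le> (2 * approx_const p q) powr (1 / p) * real d powr (1 / 2 * (1 - q / p)) * lp_regression_min p A b}"
proof -
  define f where "f = (\<lambda>j i. A $$ (i, j))"
  have X: "finite {..<n}" "{..<n} \<noteq> {}" using n by (auto simp: lessThan_empty_iff)
  \<comment> \<open>Here \<open>b\<close> is indexed by the sample number and not by the row, since
    the algorithm sees only the list of values read.\<close>
  define near where "near = (\<lambda>P (S :: nat \<Rightarrow> nat) b c. \<forall>c'.
     (\<Sum>s<m. \<bar>(\<Sum>j<d. c j * (f j (S s) / pmf P (S s) powr (1 / p))) - b s / pmf P (S s) powr (1 / p)\<bar> powr q)
     \<le> 2 * (\<Sum>s<m. \<bar>(\<Sum>j<d. c' j * (f j (S s) / pmf P (S s) powr (1 / p))) - b s / pmf P (S s) powr (1 / p)\<bar> powr q))"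
  obtain P where PX: "set_pmf P = {..<n}"
    and P: "\<And>b x. 99 / 100 \<le> measure_pmf.prob (Pi_pmf {..<m} 0 (\<lambda>_. P))
      {S. \<forall>c. near P S (\<lambda>s. b (S s)) c \<longrightarrow> (\<Sum>i<n. \<bar>(\<Sum>j<d. c j * f j i) - b i\<bar> powr p)
         \<le> approx_const p q * real d powr ((p - q) / 2) * (\<Sum>i<n. \<bar>(\<Sum>j<d. x j * f j i) - b i\<bar> powr p)}"
    using regression_from_samples[OF X d q m m0, where f = f and dflt = 0] unfolding near_def by blast
  let ?Q = "Pi_pmf {..<m} 0 (\<lambda>_. P)"
  define sol where "sol S vs = (SOME c. near P S (\<lambda>s. vs ! s) c)" for S vs
  have sol: "near P S (\<lambda>s. vs ! s) (sol S vs)" for S vs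
  proof -
    have "\<exists>c. near P S (\<lambda>s. vs ! s) c"
      unfolding near_def by (rule near_minimizer) (use q in auto)
    then show ?thesis unfolding sol_def by (rule someI_ex)
  qed
  define tree where "tree S = query_list (map S [0..<m]) (\<lambda>vs. Matrix.vec d (sol S vs))" for S
  have near_cong: "near P S b c \<Longrightarrow> (\<And>s. s < m \<Longrightarrow> b s = b' s) \<Longrightarrow> near P S b' c" for S b b' c
    unfolding near_def by simp
  have "(\<forall>T \<in> set_pmf (map_pmf tree ?Q). set (reads T b) \<subseteq> {..<n} \<and> length (reads T b) = m \<and> run T b \<in> carrier_vec d) \<and>
     99 / 100 \<le> measure_pmf.prob (map_pmf tree ?Q) {T. lp_norm p (A *\<^sub>v run T b - b)
        \<le> (2 * approx_const p q) powr (1 / p) * real d powr (1 / 2 * (1 - q / p)) * lp_regression_min p A b}"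
    if b: "b \<in> carrier_vec n" for b
  proof (intro conjI ballI)
    fix T assume "T \<in> set_pmf (map_pmf tree ?Q)"
    then obtain S where S: "S \<in> set_pmf ?Q" and T: "T = tree S" by auto
    have "S s < n" if "s < m" for s
      using S that set_Pi_pmf_subset'[of "{..<m}" 0 "\<lambda>_. P"] PX by (auto simp: PiE_dflt_def)
    then show "set (reads T b) \<subseteq> {..<n}" by (auto simp: T tree_def reads_query_list)
    show "length (reads T b) = m" by (simp add: T tree_def reads_query_list)
    show "run T b \<in> carrier_vec d" by (simp add: T tree_def run_query_list)
  next
    define \<phi> where "\<phi> c = (\<Sum>i<n. \<bar>(\<Sum>j<d. c j * f j i) - b $ i\<bar> powr p)" for c
    have \<phi>0: "0 \<le> \<phi> c" for c unfolding \<phi>_def by (intro sum_nonneg) auto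
    \<comment> \<open>The comparison point depends on \<open>b\<close> but not on the sample, so the
      probability bound for a fixed \<open>x\<close> applies; being only near-optimal costs the
      factor 2 under the \<open>p\<close>-th root.\<close>
    obtain x where x: "\<And>c'. \<phi> x \<le> 2 * \<phi> c'"
      using near_minimizer[OF X(1), where q = p and d = d and f = f and b = "($) b"] q unfolding \<phi>_def by auto
    define \<alpha> where "\<alpha> = (2 * approx_const p q) powr (1 / p) * real d powr (1 / 2 * (1 - q / p))"
    have \<alpha>: "0 < \<alpha>" unfolding \<alpha>_def using approx_const_pos[of p q] d by simp
    have lp: "lp_norm p (A *\<^sub>v y - b) = \<phi> (($) y) powr (1 / p)" if "y \<in> carrier_vec d" for y
      unfolding \<phi>_def f_def by (rule lp_norm_mult_minus[OF A b that])
    have good: "lp_norm p (A *\<^sub>v run (tree S) b - b) \<le> \<alpha> * lp_regression_min p A b"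
      if S: "\<forall>c. near P S (\<lambda>s. b $ S s) c \<longrightarrow> \<phi> c \<le> approx_const p q * real d powr ((p - q) / 2) * \<phi> x" for S
    proof -
      define c where "c = sol S (map (($) b) (map S [0..<m]))"
      have "near P S (\<lambda>s. b $ S s) c"
        unfolding c_def by (rule near_cong[OF sol]) auto
      then have c: "\<phi> c \<le> approx_const p q * real d powr ((p - q) / 2) * \<phi> x" using S by blast
      have run: "run (tree S) b = Matrix.vec d c" by (simp add: tree_def run_query_list c_def)
      have \<phi>c: "\<phi> (($) (Matrix.vec d c)) = \<phi> c" by (simp add: \<phi>_def)
      have each: "lp_norm p (A *\<^sub>v run (tree S) b - b) \<le> \<alpha> * lp_norm p (A *\<^sub>v y - b)" if y: "y \<in> carrier_vec d" for y
      proof -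
        have "\<phi> c \<le> approx_const p q * real d powr ((p - q) / 2) * (2 * \<phi> (($) y))"
          using approx_const_pos[of p q] by (intro order_trans[OF c] mult_left_mono x) auto
        then have "\<phi> c powr (1 / p) \<le> (2 * approx_const p q * real d powr ((p - q) / 2) * \<phi> (($) y)) powr (1 / p)"
          using q \<phi>0 by (intro powr_mono2) (auto simp: mult_ac)
        also have "\<dots> = (2 * approx_const p q) powr (1 / p) * real d powr ((p - q) / 2 * (1 / p)) * \<phi> (($) y) powr (1 / p)"
          by (simp add: powr_mult powr_powr)
        also have "(p - q) / 2 * (1 / p) = 1 / 2 * (1 - q / p)" using q by (simp add: field_simps)
        finally show ?thesis unfolding run lp[OF y] lp[OF vec_carrier] \<phi>c \<alpha>_def .
      qed
      \<comment> \<open>The bound holds against every \<open>y\<close>; dividing by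
        \<open>\<alpha>\<close> lets it pass to the infimum, whether or not that is
        attained.\<close>
      have "lp_norm p (A *\<^sub>v run (tree S) b - b) / \<alpha> \<le> lp_regression_min p A b"
        unfolding lp_regression_min_def
      proof (rule cINF_greatest)
        show "carrier_vec (dim_col A) \<noteq> ({} :: real Matrix.vec set)" using zero_carrier_vec by blast
      qed (use each \<alpha> A in \<open>auto simp: pos_divide_le_eq mult.commute\<close>)
      then show ?thesis using \<alpha> by (simp add: pos_divide_le_eq mult.commute)
    qed
    have "99 / 100 \<le> measure_pmf.prob ?Q
      {S. \<forall>c. near P S (\<lambda>s. b $ S s) c \<longrightarrow> \<phi> c \<le> approx_const p q * real d powr ((p - q) / 2) * \<phi> x}"
      unfolding \<phi>_def by (rule P)
    also have "\<dots> \<le> measure_pmf.prob ?Q (tree -` {T. lp_norm p (A *\<^sub>v run T b - b) \<le> \<alpha> * lp_regression_min p A b})"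
      using good by (intro measure_pmf.finite_measure_mono) auto
    finally show "99 / 100 \<le> measure_pmf.prob (map_pmf tree ?Q) {T. lp_norm p (A *\<^sub>v run T b - b)
        \<le> (2 * approx_const p q) powr (1 / p) * real d powr (1 / 2 * (1 - q / p)) * lp_regression_min p A b}"
      by (simp add: \<alpha>_def)
  qed
  then show ?thesis by blast
qed

theorem theorem14p3:
  fixes p q :: real
  assumes "2 \<le> q" and "q < p"
  shows "\<exists>K > 0. \<exists>C > 0. \<exists>alg :: real Matrix.mat \<Rightarrow> real Matrix.vec query_tree pmf.
    \<forall>(n :: nat) (d :: nat) A b.
      n \<ge> 1 \<longrightarrow> d \<ge> 1 \<longrightarrow> A \<in> carrier_mat n d \<longrightarrow> b \<in> carrier_vec n \<longrightarrow>
        (\<forall>T \<in> set_pmf (alg A).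
            set (reads T b) \<subseteq> {..<n} \<and>
            real (length (reads T b)) \<le> K * (real d powr (q / 2) * log1 d ^ 3) \<and>
            run T b \<in> carrier_vec d) \<and>
        measure_pmf.prob (alg A)
          {T. lp_norm p (A *\<^sub>v run T b - b)
                \<le> C * real d powr (1 / 2 * (1 - q / p)) * lp_regression_min p A b}
          \<ge> 99 / 100"
proof -
  define K0 where "K0 = sample_const q"
  have K0: "0 < K0" unfolding K0_def sample_const_def using assms by (intro mult_pos_pos add_pos_pos) auto
  \<comment> \<open>The construction uses two logarithmic factors; the stated bound follows from
    \<open>log1 d \<ge> 1\<close>, and rounding up is absorbed by adding 1 to the constant.\<close>
  define m where "m d = nat \<lceil>K0 * (real d powr (q / 2) * log1 d ^ 2)\<rceil>" for d
  define C where "C = (2 * approx_const p q) powr (1 / p)"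
  have C: "0 < C" unfolding C_def using approx_const_pos[of p q] by simp
  have base: "0 < real d powr (q / 2) * log1 d ^ 2" "1 \<le> real d powr (q / 2) * log1 d ^ 3"
    "real d powr (q / 2) * log1 d ^ 2 \<le> real d powr (q / 2) * log1 d ^ 3" if "1 \<le> d" for d
  proof -
    have l: "1 \<le> log1 d" by (rule log1_ge)
    have dq: "1 \<le> real d powr (q / 2)" using that assms by (intro ge_one_powr_ge_zero) auto
    show "0 < real d powr (q / 2) * log1 d ^ 2" using l that by (intro mult_pos_pos zero_less_power) auto
    have "1 * 1 \<le> real d powr (q / 2) * log1 d ^ 3" using l dq by (intro mult_mono one_le_power) auto
    then show "1 \<le> real d powr (q / 2) * log1 d ^ 3" by simp
    show "real d powr (q / 2) * log1 d ^ 2 \<le> real d powr (q / 2) * log1 d ^ 3"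
      using l by (intro mult_left_mono power_increasing) auto
  qed
  have mbound: "real (m d) \<le> (K0 + 1) * (real d powr (q / 2) * log1 d ^ 3)" if "1 \<le> d" for d
  proof -
    have "0 \<le> K0 * (real d powr (q / 2) * log1 d ^ 2)" using base(1)[OF that] K0 by simp
    then have "real (m d) \<le> K0 * (real d powr (q / 2) * log1 d ^ 2) + 1" unfolding m_def by linarith
    also have "\<dots> \<le> K0 * (real d powr (q / 2) * log1 d ^ 3) + 1 * (real d powr (q / 2) * log1 d ^ 3)"
      using mult_left_mono[OF base(3)[OF that], of K0] base(2)[OF that] K0 by linarith
    finally show ?thesis by (simp add: distrib_right)
  qed
  \<comment> \<open>The specification reads both dimensions off \<open>A\<close> and quantifies over
    \<open>b\<close> inside, so that the distribution chosen by \<open>SOME\<close> is a function of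
    \<open>A\<close> alone.\<close>
  define spec where "spec A M \<longleftrightarrow> (\<forall>b \<in> carrier_vec (dim_row A).
     (\<forall>T \<in> set_pmf M. set (reads T b) \<subseteq> {..<dim_row A} \<and> length (reads T b) = m (dim_col A) \<and> run T b \<in> carrier_vec (dim_col A)) \<and>
     99 / 100 \<le> measure_pmf.prob M {T. lp_norm p (A *\<^sub>v run T b - b)
        \<le> C * real (dim_col A) powr (1 / 2 * (1 - q / p)) * lp_regression_min p A b})"
    for A :: "real mat" and M
  define alg where "alg A = (SOME M. spec A M)" for A
  have alg: "spec A (alg A)" if A: "A \<in> carrier_mat n d" and n: "1 \<le> n" and d: "1 \<le> d" for A n d
  proof -
    have pos: "0 < K0 * (real d powr (q / 2) * log1 d ^ 2)" using base(1)[OF d] K0 by simp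
    have "K0 * (real d powr (q / 2) * log1 d ^ 2) \<le> real (m d)" "0 < m d"
      using pos unfolding m_def by linarith+
    then have "\<exists>M. spec A M"
      using randomized_algorithm[OF assms n d A, of "m d"] A unfolding spec_def C_def K0_def by auto
    then show ?thesis unfolding alg_def by (rule someI_ex)
  qed
  have "(\<forall>T \<in> set_pmf (alg A).
            set (reads T b) \<subseteq> {..<n} \<and>
            real (length (reads T b)) \<le> (K0 + 1) * (real d powr (q / 2) * log1 d ^ 3) \<and>
            run T b \<in> carrier_vec d) \<and>
        measure_pmf.prob (alg A)
          {T. lp_norm p (A *\<^sub>v run T b - b)
                \<le> C * real d powr (1 / 2 * (1 - q / p)) * lp_regression_min p A b}
          \<ge> 99 / 100"
    if "n \<ge> 1" "d \<ge> 1" "A \<in> carrier_mat n d" "b \<in> carrier_vec n" for n d A b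
    using alg[OF that(3,1,2)] that mbound[OF that(2)] unfolding spec_def by auto
  then show ?thesis using K0 C
    by (intro exI[of _ "K0 + 1"] exI[of _ C] exI[of _ alg] conjI allI impI) auto
qed

end
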